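(* Let $\mathrm{U},\mathrm{V}$ be Banach spaces and $\mathrm{W}:=L(\mathrm{U},\mathrm{V})$. Let $p\geq 1$, let $k\geq 1$ be an integer, $\gamma\in(0,1]$, $\kappa\in(0,1)$, $\overline{\kappa}:=1-\kappa$, and set $q:=p/(\kappa\gamma)$. Let $f$ be of class $\mathcal{C}^{k+\gamma}$ from $\mathrm{V}$ to $\mathrm{W}$, and set $\mathfrak{O}f(y):=(f(y_t))_{t\in[0,T]}$. Then $\mathfrak{O}f$ is of class $\mathcal{C}^{k+\overline{\kappa}\gamma}$ from any ball of radius $\rho>0$ of $\mathrm{C}_p(\mathrm{V})$ to $\mathrm{C}_q(\mathrm{W})$. Besides, its Fréchet derivative at $y$ in the direction $h$ is $$\mathrm{D}\mathfrak{O}f(y)\cdot h=(\mathrm{D}f(y_t)\cdot h_t)_{t\in[0,T]}\in\mathrm{C}_q(\mathrm{W})$$ for any $y,h\in\mathrm{C}_p(\mathrm{V})$. Finally, $\mathrm{D}\mathfrak{O}f(y)\cdot h\in\mathrm{C}^\star_q(\mathrm{W})$ when $h\in\mathrm{C}^\star_p(\mathrm{V})$.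
   Context: $T>0$ is fixed. A control is a non-negative function $\omega=(\omega_{s,t})_{0\le s\le t\le T}$ that is continuous close to the diagonal $\{(t,t):t\in[0,T]\}$ and super-additive: $\omega_{r,s}+\omega_{s,t}\leq\omega_{r,t}$ for $0\le r\le s\le t\le T$. A control $\omega$ is fixed. For a path $x:[0,T]\to\mathrm{V}$ and $p\ge1$, $\|x\|_p:=\sup_{s<t}|x_t-x_s|/\omega_{s,t}^{1/p}$ (the smallest $C$ with $|x_t-x_s|\le C\omega_{s,t}^{1/p}$ for all $s\le t$). $\mathrm{C}_p(\mathrm{V})$ is the Banach space of paths with $\|x\|_p<\infty$, with norm $|x_0|+\|x\|_p$, and $\mathrm{C}_p^\star(\mathrm{V}):=\{x\in\mathrm{C}_p(\mathrm{V}): x_0=0\}$; similarly for other exponents and other Banach spaces. $L(\mathrm{U},\mathrm{V})$ is the space of continuous linear maps. For an integer $k\ge0$ and $\gamma\in(0,1]$, a function between Banach spaces (or from a ball of a Banach space to a Banach space) is of class $\mathcal{C}^{k+\gamma}$ if it is bounded and continuous, has bounded continuous Fréchet derivatives up to order $k$, and its derivative of order $k$ is globally $\gamma$-Hölder continuous on the domain. *)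

theory Defs
  imports "HOL-Analysis.Analysis" "HOL-Library.Function_Algebras"
begin

text \<open>
  The space of paths depends on the horizon, the control and the exponent, hence on terms, so it
  cannot be a type. Normed spaces are therefore given by a carrier (a linear subspace of a real
  vector space) and a norm on it. Functions form a real vector space pointwise.
\<close>

instantiation "fun" :: (type, real_vector) real_vector
begin

definition scaleR_fun :: "real \<Rightarrow> ('a \<Rightarrow> 'b) \<Rightarrow> 'a \<Rightarrow> 'b"
  where "scaleR_fun c f = (\<lambda>x. c *\<^sub>R f x)"

instance
  by standard (auto simp: scaleR_fun_def fun_eq_iff algebra_simps)

end

record 'a nspace =
  ncarrier :: "'a set"
  nnorm :: "'a \<Rightarrow> real"

definition type_nspace :: "'a::real_normed_vector nspace"
  where "type_nspace = \<lparr>ncarrier = UNIV, nnorm = norm\<rparr>"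

definition nball :: "'a::real_vector nspace \<Rightarrow> 'a \<Rightarrow> real \<Rightarrow> 'a set"
  where "nball X c \<rho> = {y \<in> ncarrier X. nnorm X (y - c) < \<rho>}"

definition nbounded_linear ::
    "'a::real_vector nspace \<Rightarrow> 'b::real_vector nspace \<Rightarrow> ('a \<Rightarrow> 'b) \<Rightarrow> bool"
  where "nbounded_linear X Y L \<longleftrightarrow>
    (\<forall>x\<in>ncarrier X. L x \<in> ncarrier Y) \<and>
    (\<forall>x\<in>ncarrier X. \<forall>y\<in>ncarrier X. L (x + y) = L x + L y) \<and>
    (\<forall>c. \<forall>x\<in>ncarrier X. L (c *\<^sub>R x) = c *\<^sub>R L x) \<and>
    (\<exists>C. \<forall>x\<in>ncarrier X. nnorm Y (L x) \<le> C * nnorm X x)"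

definition ncontinuous_on ::
    "'a::real_vector nspace \<Rightarrow> 'b::real_vector nspace \<Rightarrow> 'a set \<Rightarrow> ('a \<Rightarrow> 'b) \<Rightarrow> bool"
  where "ncontinuous_on X Y S F \<longleftrightarrow>
    (\<forall>y\<in>S. \<forall>\<epsilon>>0. \<exists>\<delta>>0. \<forall>z\<in>S. nnorm X (z - y) < \<delta> \<longrightarrow> nnorm Y (F z - F y) < \<epsilon>)"

definition nbounded_on ::
    "'b::real_vector nspace \<Rightarrow> 'a set \<Rightarrow> ('a \<Rightarrow> 'b) \<Rightarrow> bool"
  where "nbounded_on Y S F \<longleftrightarrow> (\<exists>M. \<forall>y\<in>S. nnorm Y (F y) \<le> M)"

definition nholder_on ::
    "'a::real_vector nspace \<Rightarrow> 'b::real_vector nspace \<Rightarrow> real \<Rightarrow> 'a set \<Rightarrow> ('a \<Rightarrow> 'b) \<Rightarrow> bool"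
  where "nholder_on X Y \<gamma> S F \<longleftrightarrow>
    (\<exists>C. \<forall>y\<in>S. \<forall>z\<in>S. nnorm Y (F z - F y) \<le> C * nnorm X (z - y) powr \<gamma>)"

definition has_nfrechet ::
    "'a::real_vector nspace \<Rightarrow> 'b::real_vector nspace \<Rightarrow> 'a set \<Rightarrow> ('a \<Rightarrow> 'b) \<Rightarrow> ('a \<Rightarrow> 'b) \<Rightarrow> 'a \<Rightarrow> bool"
  where "has_nfrechet X Y S F F' y \<longleftrightarrow>
    S \<subseteq> ncarrier X \<and> y \<in> S \<and> F ` S \<subseteq> ncarrier Y \<and> nbounded_linear X Y F' \<and>
    (\<forall>\<epsilon>>0. \<exists>\<delta>>0. \<forall>z\<in>S. nnorm X (z - y) < \<delta> \<longrightarrow>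
       nnorm Y (F z - F y - F' (z - y)) \<le> \<epsilon> * nnorm X (z - y))"

text \<open>On types, this is the derivative of the library.\<close>

lemma has_nfrechet_type_nspace_iff:
  "has_nfrechet type_nspace type_nspace S F F' y \<longleftrightarrow>
     y \<in> S \<and> (F has_derivative F') (at y within S)"
proof -
  have "nbounded_linear type_nspace type_nspace F' \<longleftrightarrow> bounded_linear F'"
    unfolding nbounded_linear_def type_nspace_def bounded_linear_def bounded_linear_axioms_def
      linear_iff
    by (simp add: mult.commute)
  then show ?thesis
    unfolding has_nfrechet_def has_derivative_within_alt
    by (auto simp: type_nspace_def)
qed

text \<open>
  \<open>multilin X Y j\<close> is the space of bounded \<open>j\<close>-linear maps, which is isometric to
  \<open>L(X, L(X, \<dots> L(X, Y)))\<close>. The arguments are given as a list of length \<open>j\<close>, and the maps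
  are set to zero off the admissible lists, so that equal maps are equal functions.
\<close>

definition mlists :: "'a nspace \<Rightarrow> nat \<Rightarrow> 'a list set"
  where "mlists X j = {hs. length hs = j \<and> set hs \<subseteq> ncarrier X}"

definition mbound ::
    "'a nspace \<Rightarrow> 'b nspace \<Rightarrow> nat \<Rightarrow> ('a list \<Rightarrow> 'b) \<Rightarrow> real \<Rightarrow> bool"
  where "mbound X Y j M C \<longleftrightarrow>
    0 \<le> C \<and> (\<forall>hs\<in>mlists X j. nnorm Y (M hs) \<le> C * prod_list (map (nnorm X) hs))"

definition multilin ::
    "'a::real_vector nspace \<Rightarrow> 'b::real_vector nspace \<Rightarrow> nat \<Rightarrow> ('a list \<Rightarrow> 'b) nspace"
  where "multilin X Y j = \<lparr>
    ncarrier = {M.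
      (\<forall>hs\<in>mlists X j. M hs \<in> ncarrier Y) \<and>
      (\<forall>hs. hs \<notin> mlists X j \<longrightarrow> M hs = 0) \<and>
      (\<forall>hs\<in>mlists X j. \<forall>i<j. \<forall>a\<in>ncarrier X. \<forall>b\<in>ncarrier X.
         M (hs[i := a + b]) = M (hs[i := a]) + M (hs[i := b])) \<and>
      (\<forall>hs\<in>mlists X j. \<forall>i<j. \<forall>c. \<forall>a\<in>ncarrier X.
         M (hs[i := c *\<^sub>R a]) = c *\<^sub>R M (hs[i := a])) \<and>
      (\<exists>C. mbound X Y j M C)},
    nnorm = (\<lambda>M. Inf {C. mbound X Y j M C})\<rparr>"

text \<open>
  Functions of class \<open>\<C>\<^sup>k\<^sup>+\<^sup>\<gamma>\<close> from \<open>S\<close> to \<open>Y\<close>. The map \<open>D j\<close> is the derivative of order \<open>j\<close>,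
  that of order zero being \<open>F\<close> itself, seen as a map on the empty list; \<open>D (j + 1) y (h # hs)\<close> is
  the derivative at \<open>y\<close> in the direction \<open>h\<close> of \<open>D j\<close>, evaluated at \<open>hs\<close>.
\<close>

definition holder_class ::
    "nat \<Rightarrow> real \<Rightarrow> 'a::real_vector nspace \<Rightarrow> 'b::real_vector nspace \<Rightarrow> 'a set \<Rightarrow> ('a \<Rightarrow> 'b) \<Rightarrow> bool"
  where "holder_class k \<gamma> X Y S F \<longleftrightarrow>
    S \<subseteq> ncarrier X \<and> F ` S \<subseteq> ncarrier Y \<and>
    (\<exists>D :: nat \<Rightarrow> 'a \<Rightarrow> 'a list \<Rightarrow> 'b.
      (\<forall>y\<in>S. D 0 y = (\<lambda>hs. if hs = [] then F y else 0)) \<and>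
      (\<forall>j\<le>k. (\<forall>y\<in>S. D j y \<in> ncarrier (multilin X Y j)) \<and>
         nbounded_on (multilin X Y j) S (D j) \<and>
         ncontinuous_on X (multilin X Y j) S (D j)) \<and>
      (\<forall>j<k. \<forall>y\<in>S.
         has_nfrechet X (multilin X Y j) S (D j) (\<lambda>h hs. D (Suc j) y (h # hs)) y) \<and>
      nholder_on X (multilin X Y k) \<gamma> S (D k))"

definition control :: "real \<Rightarrow> (real \<Rightarrow> real \<Rightarrow> real) \<Rightarrow> bool"
  where "control T \<omega> \<longleftrightarrow>
    (\<forall>s t. 0 \<le> s \<and> s \<le> t \<and> t \<le> T \<longrightarrow> 0 \<le> \<omega> s t) \<and>
    (\<exists>N. open N \<and> (\<forall>t\<in>{0..T}. (t, t) \<in> N) \<and>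
       continuous_on (N \<inter> {(s, t). 0 \<le> s \<and> s \<le> t \<and> t \<le> T}) (\<lambda>(s, t). \<omega> s t)) \<and>
    (\<forall>r s t. 0 \<le> r \<and> r \<le> s \<and> s \<le> t \<and> t \<le> T \<longrightarrow> \<omega> r s + \<omega> s t \<le> \<omega> r t)"

text \<open>
  A path on \<open>[0, T]\<close> is a function vanishing outside of \<open>[0, T]\<close>. The seminorm is the
  smallest admissible constant, since \<open>\<omega> s t\<close> may be zero for \<open>s < t\<close>.
\<close>

definition path_bound ::
    "real \<Rightarrow> (real \<Rightarrow> real \<Rightarrow> real) \<Rightarrow> real \<Rightarrow> (real \<Rightarrow> 'v::real_normed_vector) \<Rightarrow> real \<Rightarrow> bool"
  where "path_bound T \<omega> p x C \<longleftrightarrow>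
    0 \<le> C \<and> (\<forall>s t. 0 \<le> s \<and> s \<le> t \<and> t \<le> T \<longrightarrow> norm (x t - x s) \<le> C * \<omega> s t powr (1 / p))"

definition path_seminorm ::
    "real \<Rightarrow> (real \<Rightarrow> real \<Rightarrow> real) \<Rightarrow> real \<Rightarrow> (real \<Rightarrow> 'v::real_normed_vector) \<Rightarrow> real"
  where "path_seminorm T \<omega> p x = Inf {C. path_bound T \<omega> p x C}"

definition path_space ::
    "real \<Rightarrow> (real \<Rightarrow> real \<Rightarrow> real) \<Rightarrow> real \<Rightarrow> (real \<Rightarrow> 'v::real_normed_vector) nspace"
  where "path_space T \<omega> p = \<lparr>
    ncarrier = {x. (\<forall>t. t \<notin> {0..T} \<longrightarrow> x t = 0) \<and> (\<exists>C. path_bound T \<omega> p x C)},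
    nnorm = (\<lambda>x. norm (x 0) + path_seminorm T \<omega> p x)\<rparr>"

definition path_space_star ::
    "real \<Rightarrow> (real \<Rightarrow> real \<Rightarrow> real) \<Rightarrow> real \<Rightarrow> (real \<Rightarrow> 'v::real_normed_vector) set"
  where "path_space_star T \<omega> p = {x \<in> ncarrier (path_space T \<omega> p). x 0 = 0}"

definition path_of :: "real \<Rightarrow> (real \<Rightarrow> 'w::zero) \<Rightarrow> real \<Rightarrow> 'w"
  where "path_of T g = (\<lambda>t. if t \<in> {0..T} then g t else 0)"

definition nemytskii :: "real \<Rightarrow> ('v \<Rightarrow> 'w::zero) \<Rightarrow> (real \<Rightarrow> 'v) \<Rightarrow> real \<Rightarrow> 'w"
  where "nemytskii T f y = path_of T (\<lambda>t. f (y t))"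

end

theory Submission
  imports Defs
begin

text \<open>
  The derivative of order \<open>j\<close> of the Nemytskii operator at \<open>y\<close> is the pointwise one,
  \<open>t \<mapsto> D\<^sup>jf(y\<^sub>t)(h\<^sub>1\<^sub>,\<^sub>t, \<dots>, h\<^sub>j\<^sub>,\<^sub>t)\<close>. The \<open>\<gamma>\<close>-Hoelder increments of \<open>D\<^sup>jf\<close> along \<open>y\<close> and \<open>z\<close> are
  bounded by a multiple of \<open>\<parallel>z - y\<parallel>\<close> to the power \<open>\<gamma>\<close> and also by a multiple of \<open>\<omega>\<close> to the power
  \<open>\<gamma> / p\<close>. Interpolating with weights \<open>1 - \<kappa>\<close> and \<open>\<kappa>\<close> shows that each of these candidates is Hoelder
  of exponent \<open>(1 - \<kappa>)\<gamma>\<close> with values in the paths of exponent \<open>q\<close>. The mean value inequality on the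
  segment from \<open>y\<close> to \<open>z\<close> then turns this bound for order \<open>j + 1\<close> into differentiability of
  order \<open>j\<close>.
\<close>

section \<open>Seminormed carriers\<close>

text \<open>The loss from \<open>\<gamma>\<close> to \<open>(1 - \<kappa>) * \<gamma>\<close> comes
  from the rectangular increment \<open>D j (z t) - D j (z s) - D j (y t) + D j (y s)\<close>.
  Grouped by time it is small with \<open>z - y\<close>; grouped by path it is small with
  \<open>t - s\<close>. Hoelder continuity of \<open>D k\<close> gives each gain alone and not their
  product, so a weighted geometric mean has to do; the weight \<open>\<kappa>\<close> leaves
  \<open>\<omega>\<close> to the power \<open>\<kappa> * \<gamma> / p\<close>, and this is
  \<open>1 / q\<close>. The arguments \<open>h\<close> move in time too, but with the better
  exponent \<open>1 / p\<close>, whose surplus is absorbed by powers of \<open>\<omega> 0 T\<close>.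
  The constants depend on the paths only through a bound \<open>R\<close> on their norms: hence
  Hoelder classes on balls, but derivatives, being local, at every path. Differentiability in the
  path norm is reduced to functions of one real variable with values in \<open>'w\<close>: lists of
  directions and pairs of times are fixed first, and the resulting estimates are uniform in
  them.\<close>

definition seminormed :: "'a::real_vector nspace \<Rightarrow> bool"
  where "seminormed X \<longleftrightarrow>
    (\<forall>x\<in>ncarrier X. \<forall>y\<in>ncarrier X. x + y \<in> ncarrier X \<and> nnorm X (x + y) \<le> nnorm X x + nnorm X y) \<and>
    (\<forall>c. \<forall>x\<in>ncarrier X. c *\<^sub>R x \<in> ncarrier X \<and> nnorm X (c *\<^sub>R x) \<le> \<bar>c\<bar> * nnorm X x) \<and>
    (\<forall>x\<in>ncarrier X. 0 \<le> nnorm X x)"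

lemma seminormedD:
  assumes "seminormed X"
  shows "x \<in> ncarrier X \<Longrightarrow> y \<in> ncarrier X \<Longrightarrow> x + y \<in> ncarrier X"
    and "x \<in> ncarrier X \<Longrightarrow> y \<in> ncarrier X \<Longrightarrow> nnorm X (x + y) \<le> nnorm X x + nnorm X y"
    and "x \<in> ncarrier X \<Longrightarrow> c *\<^sub>R x \<in> ncarrier X"
    and "x \<in> ncarrier X \<Longrightarrow> nnorm X (c *\<^sub>R x) \<le> \<bar>c\<bar> * nnorm X x"
    and "x \<in> ncarrier X \<Longrightarrow> 0 \<le> nnorm X x"
  using assms unfolding seminormed_def by auto

lemma seminormed_diff:
  assumes "seminormed X" "x \<in> ncarrier X" "y \<in> ncarrier X"
  shows "x - y \<in> ncarrier X" "nnorm X (x - y) \<le> nnorm X x + nnorm X y"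
proof -
  have eq: "x - y = x + (- 1) *\<^sub>R y"
    by simp
  have y: "(- 1) *\<^sub>R y \<in> ncarrier X" "nnorm X ((- 1) *\<^sub>R y) \<le> nnorm X y"
    using seminormedD(3)[OF assms(1,3), of "- 1"] seminormedD(4)[OF assms(1,3), of "- 1"]
    by simp_all
  show "x - y \<in> ncarrier X"
    unfolding eq by (rule seminormedD(1)[OF assms(1,2) y(1)])
  show "nnorm X (x - y) \<le> nnorm X x + nnorm X y"
    unfolding eq using seminormedD(2)[OF assms(1,2) y(1)] y(2) by linarith
qed

lemma seminormed_type_nspace: "seminormed type_nspace"
  by (auto simp: seminormed_def type_nspace_def norm_triangle_ineq)

lemma seminormed_prod_list_nonneg:
  assumes "seminormed X" "set hs \<subseteq> ncarrier X"
  shows "0 \<le> prod_list (map (nnorm X) hs)"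
  using assms(2) by (induction hs) (auto intro!: mult_nonneg_nonneg seminormedD(5)[OF assms(1)])

lemma nholder_on_imp_ncontinuous_on:
  assumes X: "seminormed X" and S: "S \<subseteq> ncarrier X" and "0 < \<alpha>" and "nholder_on X Y \<alpha> S F"
  shows "ncontinuous_on X Y S F"
  unfolding ncontinuous_on_def
proof (intro ballI allI impI)
  fix y \<epsilon> :: _ assume y: "y \<in> S" and e: "0 < (\<epsilon>::real)"
  obtain C where C: "\<And>y z. y \<in> S \<Longrightarrow> z \<in> S \<Longrightarrow> nnorm Y (F z - F y) \<le> C * nnorm X (z - y) powr \<alpha>"
    using assms(4) unfolding nholder_on_def by auto
  \<comment> \<open>\<open>nholder_on\<close> does not fix the sign of its constant;
    \<open>B\<close> is a positive majorant, and \<open>\<delta>\<close> below solves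
    \<open>B * \<delta> powr \<alpha> = \<epsilon>\<close>.\<close>
  define B where "B = \<bar>C\<bar> + 1"
  have B: "0 < B" "C \<le> B"
    by (auto simp: B_def)
  define \<delta> where "\<delta> = (\<epsilon> / B) powr (1 / \<alpha>)"
  have "nnorm Y (F z - F y) < \<epsilon>" if z: "z \<in> S" "nnorm X (z - y) < \<delta>" for z
  proof -
    have "0 \<le> nnorm X (z - y)"
      using seminormedD(5)[OF X seminormed_diff(1)[OF X]] S y z by auto
    then have "nnorm X (z - y) powr \<alpha> < \<delta> powr \<alpha>"
      using \<open>0 < \<alpha>\<close> z by (intro powr_less_mono2)
    also have "\<dots> = \<epsilon> / B"
      using \<open>0 < \<alpha>\<close> e B by (simp add: \<delta>_def powr_powr)
    finally have "B * nnorm X (z - y) powr \<alpha> < \<epsilon>"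
      using B by (simp add: field_simps)
    moreover have "C * nnorm X (z - y) powr \<alpha> \<le> B * nnorm X (z - y) powr \<alpha>"
      using B by (intro mult_right_mono) auto
    ultimately show ?thesis
      using C[OF y z(1)] by linarith
  qed
  moreover have "0 < \<delta>"
    using e B by (simp add: \<delta>_def)
  ultimately show "\<exists>\<delta>>0. \<forall>z\<in>S. nnorm X (z - y) < \<delta> \<longrightarrow> nnorm Y (F z - F y) < \<epsilon>"
    by blast
qed

section \<open>Multilinear maps\<close>

lemma ncarrier_multilin_iff:
  "M \<in> ncarrier (multilin X Y j) \<longleftrightarrow>
      (\<forall>hs\<in>mlists X j. M hs \<in> ncarrier Y) \<and>
      (\<forall>hs. hs \<notin> mlists X j \<longrightarrow> M hs = 0) \<and>
      (\<forall>hs\<in>mlists X j. \<forall>i<j. \<forall>a\<in>ncarrier X. \<forall>b\<in>ncarrier X.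
         M (hs[i := a + b]) = M (hs[i := a]) + M (hs[i := b])) \<and>
      (\<forall>hs\<in>mlists X j. \<forall>i<j. \<forall>c. \<forall>a\<in>ncarrier X.
         M (hs[i := c *\<^sub>R a]) = c *\<^sub>R M (hs[i := a])) \<and>
      (\<exists>C. mbound X Y j M C)"
  by (simp add: multilin_def)

lemma nnorm_multilin_le: "mbound X Y j M C \<Longrightarrow> nnorm (multilin X Y j) M \<le> C"
  unfolding multilin_def by (auto intro!: cInf_lower bdd_belowI[of _ 0] simp: mbound_def)

text \<open>The infimum is attained: where the product of the norms is positive, divide by it and
  pass to the infimum; where it vanishes, any admissible constant already forces
  \<open>nnorm Y (M hs) \<le> 0\<close>.\<close>

lemma mbound_nnorm:
  assumes X: "seminormed X" and M: "mbound X Y j M C"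
  shows "mbound X Y j M (nnorm (multilin X Y j) M)"
proof -
  have ne: "{C. mbound X Y j M C} \<noteq> {}"
    using M by auto
  have "nnorm Y (M hs) \<le> Inf {C. mbound X Y j M C} * prod_list (map (nnorm X) hs)"
    if hs: "hs \<in> mlists X j" for hs
  proof (cases "prod_list (map (nnorm X) hs) = 0")
    case True
    then show ?thesis
      using M hs by (fastforce simp: mbound_def)
  next
    case False
    then have pos: "0 < prod_list (map (nnorm X) hs)"
      using seminormed_prod_list_nonneg[OF X, of hs] hs by (auto simp: mlists_def)
    have "nnorm Y (M hs) / prod_list (map (nnorm X) hs) \<le> Inf {C. mbound X Y j M C}"
      using hs pos by (intro cInf_greatest[OF ne]) (auto simp: mbound_def pos_divide_le_eq)
    then show ?thesis
      using pos by (simp add: pos_divide_le_eq)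
  qed
  moreover have "0 \<le> Inf {C. mbound X Y j M C}"
    by (intro cInf_greatest[OF ne]) (auto simp: mbound_def)
  ultimately show ?thesis
    by (simp add: mbound_def multilin_def)
qed

lemma mbound_diff:
  assumes X: "seminormed X" and Y: "seminormed Y"
    and c: "\<And>hs. hs \<in> mlists X j \<Longrightarrow> M hs \<in> ncarrier Y" "\<And>hs. hs \<in> mlists X j \<Longrightarrow> N hs \<in> ncarrier Y"
    and b: "mbound X Y j M C" "mbound X Y j N D"
  shows "mbound X Y j (M - N) (C + D)"
  unfolding mbound_def
proof (intro conjI ballI)
  show "0 \<le> C + D"
    using b by (simp add: mbound_def)
  fix hs assume hs: "hs \<in> mlists X j"
  have "nnorm Y (M hs - N hs) \<le> nnorm Y (M hs) + nnorm Y (N hs)"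
    using c hs by (intro seminormed_diff(2)[OF Y])
  also have "\<dots> \<le> C * prod_list (map (nnorm X) hs) + D * prod_list (map (nnorm X) hs)"
    using b hs by (intro add_mono) (auto simp: mbound_def)
  finally show "nnorm Y ((M - N) hs) \<le> (C + D) * prod_list (map (nnorm X) hs)"
    by (simp add: algebra_simps)
qed

lemma multilin_diff:
  assumes X: "seminormed X" and Y: "seminormed Y"
    and M: "M \<in> ncarrier (multilin X Y j)" and N: "N \<in> ncarrier (multilin X Y j)"
  shows "M - N \<in> ncarrier (multilin X Y j)"
proof -
  obtain C D where "mbound X Y j M C" "mbound X Y j N D"
    using M N by (auto simp: ncarrier_multilin_iff)
  then have "mbound X Y j (M - N) (C + D)"
    using M N by (intro mbound_diff[OF X Y]) (auto simp: ncarrier_multilin_iff)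
  then show ?thesis
    using M N seminormed_diff(1)[OF Y]
    by (auto simp: ncarrier_multilin_iff algebra_simps)
qed

lemma Cons_mlists_iff: "h # hs \<in> mlists X (Suc j) \<longleftrightarrow> h \<in> ncarrier X \<and> hs \<in> mlists X j"
  by (auto simp: mlists_def)

lemma mbound_Cons:
  assumes X: "seminormed X" and h: "h \<in> ncarrier X" and M: "mbound X Y (Suc j) M C"
  shows "mbound X Y j (\<lambda>hs. M (h # hs)) (C * nnorm X h)"
  unfolding mbound_def
proof (intro conjI ballI)
  show "0 \<le> C * nnorm X h"
    using seminormedD(5)[OF X h] M by (simp add: mbound_def)
  fix hs assume "hs \<in> mlists X j"
  then have "h # hs \<in> mlists X (Suc j)"
    using h by (simp add: Cons_mlists_iff)
  then show "nnorm Y (M (h # hs)) \<le> C * nnorm X h * prod_list (map (nnorm X) hs)"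
    using M unfolding mbound_def by (fastforce simp: mult.assoc)
qed

text \<open>Freezing the first argument is the currying that turns order \<open>Suc j\<close> into
  linear maps with values in order \<open>j\<close>; slot \<open>i\<close> of the tail is slot
  \<open>Suc i\<close> of the whole list.\<close>

lemma multilin_Cons:
  assumes X: "seminormed X" and h: "h \<in> ncarrier X" and M: "M \<in> ncarrier (multilin X Y (Suc j))"
  shows "(\<lambda>hs. M (h # hs)) \<in> ncarrier (multilin X Y j)"
proof -
  obtain C where C: "mbound X Y (Suc j) M C"
    using M by (auto simp: ncarrier_multilin_iff)
  have add: "M (hs[i := a + b]) = M (hs[i := a]) + M (hs[i := b])"
    if "hs \<in> mlists X (Suc j)" "i < Suc j" "a \<in> ncarrier X" "b \<in> ncarrier X" for hs i a b
    using M that unfolding ncarrier_multilin_iff by blast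
  have scale: "M (hs[i := c *\<^sub>R a]) = c *\<^sub>R M (hs[i := a])"
    if "hs \<in> mlists X (Suc j)" "i < Suc j" "a \<in> ncarrier X" for hs i a c
    using M that unfolding ncarrier_multilin_iff by blast
  show ?thesis
    unfolding ncarrier_multilin_iff
  proof (intro conjI ballI allI impI)
    fix hs assume "hs \<in> mlists X j"
    then show "M (h # hs) \<in> ncarrier Y"
      using M h by (auto simp: ncarrier_multilin_iff Cons_mlists_iff)
  next
    fix hs assume "hs \<notin> mlists X j"
    then show "M (h # hs) = 0"
      using M h by (auto simp: ncarrier_multilin_iff Cons_mlists_iff)
  next
    fix hs i a b assume "hs \<in> mlists X j" "i < j" "a \<in> ncarrier X" "b \<in> ncarrier X"
    then show "M (h # hs[i := a + b]) = M (h # hs[i := a]) + M (h # hs[i := b])"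
      using add[of "h # hs" "Suc i" a b] h by (simp add: Cons_mlists_iff)
  next
    fix hs i c a assume "hs \<in> mlists X j" "i < j" "a \<in> ncarrier X"
    then show "M (h # hs[i := c *\<^sub>R a]) = c *\<^sub>R M (h # hs[i := a])"
      using scale[of "h # hs" "Suc i" a c] h by (simp add: Cons_mlists_iff)
  next
    show "\<exists>C. mbound X Y j (\<lambda>hs. M (h # hs)) C"
      using mbound_Cons[OF X h C] by blast
  qed
qed

lemma multilin_Cons_linear:
  assumes M: "M \<in> ncarrier (multilin X Y (Suc j))" and hs: "hs \<in> mlists X j"
  shows "a \<in> ncarrier X \<Longrightarrow> b \<in> ncarrier X \<Longrightarrow> M ((a + b) # hs) = M (a # hs) + M (b # hs)"
    and "a \<in> ncarrier X \<Longrightarrow> M ((c *\<^sub>R a) # hs) = c *\<^sub>R M (a # hs)"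
proof -
  show "M ((a + b) # hs) = M (a # hs) + M (b # hs)" if "a \<in> ncarrier X" "b \<in> ncarrier X"
  proof -
    have "a # hs \<in> mlists X (Suc j)"
      using hs that by (simp add: Cons_mlists_iff)
    then have "M ((a # hs)[0 := a + b]) = M ((a # hs)[0 := a]) + M ((a # hs)[0 := b])"
      using M that unfolding ncarrier_multilin_iff by blast
    then show ?thesis
      by simp
  qed
  show "M ((c *\<^sub>R a) # hs) = c *\<^sub>R M (a # hs)" if "a \<in> ncarrier X"
  proof -
    have "a # hs \<in> mlists X (Suc j)"
      using hs that by (simp add: Cons_mlists_iff)
    then have "M ((a # hs)[0 := c *\<^sub>R a]) = c *\<^sub>R M ((a # hs)[0 := a])"
      using M that unfolding ncarrier_multilin_iff by blast
    then show ?thesis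
      by simp
  qed
qed

lemma nbounded_linear_multilin_Cons:
  assumes X: "seminormed X" and M: "M \<in> ncarrier (multilin X Y (Suc j))"
  shows "nbounded_linear X (multilin X Y j) (\<lambda>h hs. M (h # hs))"
  unfolding nbounded_linear_def
proof (intro conjI ballI allI)
  fix h assume "h \<in> ncarrier X"
  then show "(\<lambda>hs. M (h # hs)) \<in> ncarrier (multilin X Y j)"
    by (rule multilin_Cons[OF X _ M])
next
  fix a b assume ab: "a \<in> ncarrier X" "b \<in> ncarrier X"
  show "(\<lambda>hs. M ((a + b) # hs)) = (\<lambda>hs. M (a # hs)) + (\<lambda>hs. M (b # hs))"
  proof
    fix hs
    show "M ((a + b) # hs) = ((\<lambda>hs. M (a # hs)) + (\<lambda>hs. M (b # hs))) hs"
    proof (cases "hs \<in> mlists X j")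
      case True
      then show ?thesis
        using multilin_Cons_linear(1)[OF M _ ab] by simp
    next
      \<comment> \<open>The equation is between functions on all lists; off the admissible ones
        every term has the default value 0.\<close>
      case False
      then show ?thesis
        using M by (simp add: ncarrier_multilin_iff Cons_mlists_iff)
    qed
  qed
next
  fix c a assume a: "a \<in> ncarrier X"
  show "(\<lambda>hs. M ((c *\<^sub>R a) # hs)) = c *\<^sub>R (\<lambda>hs. M (a # hs))"
  proof
    fix hs
    show "M ((c *\<^sub>R a) # hs) = (c *\<^sub>R (\<lambda>hs. M (a # hs))) hs"
    proof (cases "hs \<in> mlists X j")
      case True
      then show ?thesis
        using multilin_Cons_linear(2)[OF M _ a] by (simp add: scaleR_fun_def)
    next
      case False
      then show ?thesis
        using M by (simp add: ncarrier_multilin_iff Cons_mlists_iff scaleR_fun_def)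
    qed
  qed
next
  obtain C where "mbound X Y (Suc j) M C"
    using M by (auto simp: ncarrier_multilin_iff)
  then show "\<exists>C. \<forall>h\<in>ncarrier X. nnorm (multilin X Y j) (\<lambda>hs. M (h # hs)) \<le> C * nnorm X h"
    using mbound_Cons[OF X] nnorm_multilin_le by blast
qed

section \<open>Multilinear maps between normed types\<close>

abbreviation tmultilin :: "nat \<Rightarrow> ('a::real_normed_vector list \<Rightarrow> 'b::real_normed_vector) nspace"
  where "tmultilin j \<equiv> multilin type_nspace type_nspace j"

lemma type_nspace_simps [simp]:
  "ncarrier type_nspace = UNIV" "nnorm type_nspace = norm"
  by (simp_all add: type_nspace_def)

lemma mlists_type_nspace [simp]: "hs \<in> mlists type_nspace j \<longleftrightarrow> length hs = j"
  by (simp add: mlists_def)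

lemma norm_tmultilin_le:
  assumes "mbound type_nspace type_nspace j M C" "length hs = j"
    and "nnorm (tmultilin j) M \<le> B"
  shows "norm (M hs) \<le> B * prod_list (map norm hs)"
proof -
  have "norm (M hs) \<le> nnorm (tmultilin j) M * prod_list (map norm hs)"
    using mbound_nnorm[OF seminormed_type_nspace assms(1)] assms(2) by (auto simp: mbound_def)
  also have "\<dots> \<le> B * prod_list (map norm hs)"
    using assms(3) seminormed_prod_list_nonneg[OF seminormed_type_nspace, of hs]
    by (intro mult_right_mono) auto
  finally show ?thesis .
qed

lemma prod_list_map_nonneg: "(\<And>x. x \<in> set xs \<Longrightarrow> 0 \<le> f x) \<Longrightarrow> 0 \<le> prod_list (map f xs)"
  for f :: "'a \<Rightarrow> real"
  by (induction xs) auto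

lemma prod_list_map_mono:
  fixes f g :: "'a \<Rightarrow> real"
  assumes "\<And>x. x \<in> set xs \<Longrightarrow> 0 \<le> f x \<and> f x \<le> g x"
  shows "prod_list (map f xs) \<le> prod_list (map g xs)"
  using assms
proof (induction xs)
  case (Cons x xs)
  have "0 \<le> prod_list (map f xs)"
    using Cons.prems by (intro prod_list_map_nonneg) auto
  then show ?case
    using Cons.prems[of x] Cons.IH Cons.prems by (auto intro!: mult_mono intro: order_trans)
qed simp

text \<open>Telescoping over the arguments, one slot at a time.\<close>

lemma norm_tmultilin_map_diff_le:
  assumes "M \<in> ncarrier (tmultilin (length hs))"
    and "\<And>gs. length gs = length hs \<Longrightarrow> norm (M gs) \<le> B * prod_list (map norm gs)" and "0 \<le> B"
    and "\<And>h. h \<in> set hs \<Longrightarrow> norm (a h) \<le> N h \<and> norm (b h) \<le> N h \<and> norm (a h - b h) \<le> \<delta> * N h"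
  shows "norm (M (map a hs) - M (map b hs)) \<le> B * real (length hs) * \<delta> * prod_list (map N hs)"
  using assms
proof (induction hs arbitrary: M B)
  case Nil
  then show ?case by simp
next
  case (Cons h hs)
  let ?P = "prod_list (map N hs)"
  note h = Cons.prems(4)[of h, simplified]
  have dN: "0 \<le> \<delta> * N h" "0 \<le> N h"
    using h norm_ge_zero[of "a h - b h"] norm_ge_zero[of "a h"] by linarith+
  have P: "prod_list (map (norm \<circ> a) hs) \<le> ?P"
    using Cons.prems(4) by (intro prod_list_map_mono) auto
  have P0: "0 \<le> ?P"
    using Cons.prems(4) by (intro prod_list_map_nonneg) (auto intro: order_trans[OF norm_ge_zero])
  have Q0: "0 \<le> prod_list (map (norm \<circ> a) hs)"
    by (intro prod_list_map_nonneg) auto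
  have M: "M \<in> ncarrier (tmultilin (Suc (length hs)))"
    using Cons.prems(1) by simp
  have "M (a h # map a hs) = M ((a h - b h) # map a hs) + M (b h # map a hs)"
    using multilin_Cons_linear(1)[OF M, of "map a hs" "a h - b h" "b h"] by simp
  then have eq: "M (map a (h # hs)) - M (map b (h # hs)) =
      M ((a h - b h) # map a hs) + (M (b h # map a hs) - M (b h # map b hs))"
    by simp
  have 1: "norm (M ((a h - b h) # map a hs)) \<le> B * (\<delta> * N h * ?P)"
  proof -
    have "norm (M ((a h - b h) # map a hs)) \<le> B * (norm (a h - b h) * prod_list (map (norm \<circ> a) hs))"
      using Cons.prems(2)[of "(a h - b h) # map a hs"] by simp
    also have "\<dots> \<le> B * (\<delta> * N h * ?P)"
      using h P dN Q0 Cons.prems(3) by (intro mult_left_mono mult_mono) auto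
    finally show ?thesis .
  qed
  \<comment> \<open>Freezing the head at \<open>b h\<close> costs a factor \<open>N h\<close>, so
    the induction hypothesis is used for the curried map with constant \<open>B * N h\<close>; hence
    \<open>M\<close> and \<open>B\<close> are arbitrary in the induction.\<close>
  have 2: "norm (M (b h # map a hs) - M (b h # map b hs)) \<le> (B * N h) * real (length hs) * \<delta> * ?P"
  proof (rule Cons.IH)
    show "(\<lambda>hs. M (b h # hs)) \<in> ncarrier (tmultilin (length hs))"
      using multilin_Cons[OF seminormed_type_nspace _ M, of "b h"] by simp
    show "0 \<le> B * N h"
      using Cons.prems(3) dN by simp
    show "norm (a g) \<le> N g \<and> norm (b g) \<le> N g \<and> norm (a g - b g) \<le> \<delta> * N g" if "g \<in> set hs" for g
      using Cons.prems(4) that by simp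
    show "norm (M (b h # gs)) \<le> B * N h * prod_list (map norm gs)" if "length gs = length hs" for gs
    proof -
      have "norm (M (b h # gs)) \<le> B * (norm (b h) * prod_list (map norm gs))"
        using Cons.prems(2)[of "b h # gs"] that by simp
      also have "\<dots> \<le> B * (N h * prod_list (map norm gs))"
        using h Cons.prems(3) by (intro mult_left_mono mult_right_mono prod_list_map_nonneg) auto
      finally show ?thesis
        by (simp add: mult.assoc)
    qed
  qed
  have "norm (M (map a (h # hs)) - M (map b (h # hs))) \<le>
      B * (\<delta> * N h * ?P) + (B * N h) * real (length hs) * \<delta> * ?P"
    unfolding eq by (rule order_trans[OF norm_triangle_ineq add_mono[OF 1 2]])
  also have "\<dots> = B * real (length (h # hs)) * \<delta> * prod_list (map N (h # hs))"
    by (simp add: algebra_simps)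
  finally show ?case .
qed

section \<open>Path spaces\<close>

lemma ncarrier_path_space_iff:
  "x \<in> ncarrier (path_space T \<omega> p) \<longleftrightarrow> (\<forall>t. t \<notin> {0..T} \<longrightarrow> x t = 0) \<and> (\<exists>C. path_bound T \<omega> p x C)"
  by (simp add: path_space_def)

lemma nnorm_path_space: "nnorm (path_space T \<omega> p) x = norm (x 0) + path_seminorm T \<omega> p x"
  by (simp add: path_space_def)

lemma path_seminorm_le: "path_bound T \<omega> p x C \<Longrightarrow> path_seminorm T \<omega> p x \<le> C"
  unfolding path_seminorm_def by (auto intro!: cInf_lower bdd_belowI[of _ 0] simp: path_bound_def)

text \<open>The infimum is attained here as well; where \<open>\<omega> s t\<close> vanishes, any
  admissible constant makes the increment vanish, and elsewhere one can divide.\<close>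

lemma path_bound_seminorm:
  assumes "path_bound T \<omega> p x C"
  shows "path_bound T \<omega> p x (path_seminorm T \<omega> p x)"
proof -
  have ne: "{C. path_bound T \<omega> p x C} \<noteq> {}"
    using assms by auto
  have "norm (x t - x s) \<le> Inf {C. path_bound T \<omega> p x C} * \<omega> s t powr (1 / p)"
    if st: "0 \<le> s \<and> s \<le> t \<and> t \<le> T" for s t
  proof (cases "\<omega> s t powr (1 / p) = 0")
    case True
    then show ?thesis
      using assms st unfolding path_bound_def by fastforce
  next
    case False
    then have pos: "0 < \<omega> s t powr (1 / p)"
      using powr_ge_zero less_eq_real_def by metis
    have "norm (x t - x s) / \<omega> s t powr (1 / p) \<le> Inf {C. path_bound T \<omega> p x C}"
      using st pos by (intro cInf_greatest[OF ne]) (auto simp: path_bound_def pos_divide_le_eq)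
    then show ?thesis
      using pos by (simp add: pos_divide_le_eq)
  qed
  moreover have "0 \<le> Inf {C. path_bound T \<omega> p x C}"
    by (intro cInf_greatest[OF ne]) (auto simp: path_bound_def)
  ultimately show ?thesis
    by (simp add: path_bound_def path_seminorm_def)
qed

lemma ncarrier_path_bound:
  "x \<in> ncarrier (path_space T \<omega> p) \<Longrightarrow> path_bound T \<omega> p x (path_seminorm T \<omega> p x)"
  using path_bound_seminorm by (auto simp: ncarrier_path_space_iff)

lemma path_seminorm_nonneg: "x \<in> ncarrier (path_space T \<omega> p) \<Longrightarrow> 0 \<le> path_seminorm T \<omega> p x"
  by (drule ncarrier_path_bound) (simp add: path_bound_def)

lemma path_increment_le:
  assumes x: "x \<in> ncarrier (path_space T \<omega> p)" and st: "0 \<le> s" "s \<le> t" "t \<le> T"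
  shows "norm (x t - x s) \<le> nnorm (path_space T \<omega> p) x * \<omega> s t powr (1 / p)"
proof -
  have "norm (x t - x s) \<le> path_seminorm T \<omega> p x * \<omega> s t powr (1 / p)"
    using ncarrier_path_bound[OF x] st by (simp add: path_bound_def)
  also have "\<dots> \<le> nnorm (path_space T \<omega> p) x * \<omega> s t powr (1 / p)"
    by (intro mult_right_mono) (auto simp: nnorm_path_space)
  finally show ?thesis .
qed

lemma path_initial_le:
  "x \<in> ncarrier (path_space T \<omega> p) \<Longrightarrow> norm (x 0) \<le> nnorm (path_space T \<omega> p) x"
  by (drule path_seminorm_nonneg) (simp add: nnorm_path_space)

lemma nnorm_path_space_le:
  "norm (x 0) \<le> A \<Longrightarrow> path_bound T \<omega> p x B \<Longrightarrow> nnorm (path_space T \<omega> p) x \<le> A + B"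
  by (drule path_seminorm_le) (simp add: nnorm_path_space)

lemma path_bound_add:
  assumes "path_bound T \<omega> p x A" "path_bound T \<omega> p y B"
  shows "path_bound T \<omega> p (x + y) (A + B)"
  unfolding path_bound_def
proof (intro conjI allI impI)
  show "0 \<le> A + B"
    using assms by (simp add: path_bound_def)
  fix s t assume st: "0 \<le> s \<and> s \<le> t \<and> t \<le> T"
  have "norm ((x + y) t - (x + y) s) \<le> norm (x t - x s) + norm (y t - y s)"
    using norm_triangle_ineq[of "x t - x s" "y t - y s"] by (simp add: algebra_simps)
  also have "\<dots> \<le> A * \<omega> s t powr (1 / p) + B * \<omega> s t powr (1 / p)"
    using assms st by (intro add_mono) (auto simp: path_bound_def)
  finally show "norm ((x + y) t - (x + y) s) \<le> (A + B) * \<omega> s t powr (1 / p)"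
    by (simp add: algebra_simps)
qed

lemma path_bound_scaleR:
  assumes "path_bound T \<omega> p x A"
  shows "path_bound T \<omega> p (c *\<^sub>R x) (\<bar>c\<bar> * A)"
  unfolding path_bound_def
proof (intro conjI allI impI)
  show "0 \<le> \<bar>c\<bar> * A"
    using assms by (simp add: path_bound_def)
  fix s t assume st: "0 \<le> s \<and> s \<le> t \<and> t \<le> T"
  have "norm ((c *\<^sub>R x) t - (c *\<^sub>R x) s) = \<bar>c\<bar> * norm (x t - x s)"
    by (simp add: scaleR_fun_def flip: scaleR_diff_right)
  also have "\<dots> \<le> \<bar>c\<bar> * (A * \<omega> s t powr (1 / p))"
    using assms st by (intro mult_left_mono) (auto simp: path_bound_def)
  finally show "norm ((c *\<^sub>R x) t - (c *\<^sub>R x) s) \<le> \<bar>c\<bar> * A * \<omega> s t powr (1 / p)"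
    by (simp add: mult.assoc)
qed

lemma seminormed_path_space: "seminormed (path_space T \<omega> p)"
  unfolding seminormed_def
proof (intro conjI ballI allI)
  fix x y :: "real \<Rightarrow> 'a"
  assume xy: "x \<in> ncarrier (path_space T \<omega> p)" "y \<in> ncarrier (path_space T \<omega> p)"
  then have b: "path_bound T \<omega> p (x + y) (path_seminorm T \<omega> p x + path_seminorm T \<omega> p y)"
    by (auto simp: ncarrier_path_space_iff intro!: path_bound_add path_bound_seminorm)
  then show "x + y \<in> ncarrier (path_space T \<omega> p)"
    using xy by (auto simp: ncarrier_path_space_iff)
  show "nnorm (path_space T \<omega> p) (x + y) \<le> nnorm (path_space T \<omega> p) x + nnorm (path_space T \<omega> p) y"
    using path_seminorm_le[OF b] norm_triangle_ineq[of "x 0" "y 0"] by (simp add: nnorm_path_space)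
next
  fix c and x :: "real \<Rightarrow> 'a"
  assume x: "x \<in> ncarrier (path_space T \<omega> p)"
  then have b: "path_bound T \<omega> p (c *\<^sub>R x) (\<bar>c\<bar> * path_seminorm T \<omega> p x)"
    by (auto simp: ncarrier_path_space_iff intro!: path_bound_scaleR path_bound_seminorm)
  then show "c *\<^sub>R x \<in> ncarrier (path_space T \<omega> p)"
    using x by (auto simp: ncarrier_path_space_iff scaleR_fun_def)
  show "nnorm (path_space T \<omega> p) (c *\<^sub>R x) \<le> \<bar>c\<bar> * nnorm (path_space T \<omega> p) x"
    using path_seminorm_le[OF b] by (simp add: nnorm_path_space algebra_simps) (simp add: scaleR_fun_def)
next
  fix x :: "real \<Rightarrow> 'a"
  assume "x \<in> ncarrier (path_space T \<omega> p)"
  then show "0 \<le> nnorm (path_space T \<omega> p) x"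
    using path_seminorm_nonneg[of x T \<omega> p] by (simp add: nnorm_path_space)
qed

text \<open>A control grows with the interval: by super-additivity the nonnegative contributions of
  \<open>[0, s]\<close> and \<open>[t, T]\<close> can be added.\<close>

lemma control_le:
  assumes "control T \<omega>" "0 \<le> s" "s \<le> t" "t \<le> T"
  shows "0 \<le> \<omega> s t" "\<omega> s t \<le> \<omega> 0 T"
proof -
  have nn: "\<And>s t. 0 \<le> s \<Longrightarrow> s \<le> t \<Longrightarrow> t \<le> T \<Longrightarrow> 0 \<le> \<omega> s t"
    and add: "\<And>r s t. 0 \<le> r \<Longrightarrow> r \<le> s \<Longrightarrow> s \<le> t \<Longrightarrow> t \<le> T \<Longrightarrow> \<omega> r s + \<omega> s t \<le> \<omega> r t"
    using assms(1) unfolding control_def by auto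
  show "0 \<le> \<omega> s t"
    using nn assms by simp
  have "\<omega> s t \<le> \<omega> 0 t"
    using add[of 0 s t] nn[of 0 s] assms by simp
  also have "\<dots> \<le> \<omega> 0 T"
    using add[of 0 t T] nn[of t T] assms by simp
  finally show "\<omega> s t \<le> \<omega> 0 T" .
qed

text \<open>A larger exponent is traded for a smaller one, the surplus going into the fixed factor
  \<open>\<omega> 0 T\<close>. Zero values are covered because \<open>0 powr a = 0\<close> for every
  \<open>a\<close>, including \<open>a = 0\<close>.\<close>

lemma control_powr_le:
  assumes "control T \<omega>" "0 \<le> s" "s \<le> t" "t \<le> T" "a \<le> b"
  shows "\<omega> s t powr b \<le> \<omega> 0 T powr (b - a) * \<omega> s t powr a"
proof -
  have "\<omega> s t powr b = \<omega> s t powr (b - a) * \<omega> s t powr a"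
    by (simp flip: powr_add)
  also have "\<dots> \<le> \<omega> 0 T powr (b - a) * \<omega> s t powr a"
    using control_le[OF assms(1-4)] assms(5) by (intro mult_right_mono powr_mono2) auto
  finally show ?thesis .
qed

text \<open>\<open>x t\<close> is the initial value plus the increment over \<open>[0, t]\<close>,
  so the path norm dominates the sup norm on \<open>[0, T]\<close>. The factor becomes the constant
  \<open>A\<close> of \<open>path_jet\<close>.\<close>

lemma norm_path_le:
  assumes "control T \<omega>" "0 \<le> p" "x \<in> ncarrier (path_space T \<omega> p)" "0 \<le> t" "t \<le> T"
  shows "norm (x t) \<le> (1 + \<omega> 0 T powr (1 / p)) * nnorm (path_space T \<omega> p) x"
proof -
  have nn: "0 \<le> nnorm (path_space T \<omega> p) x"
    using seminormedD(5)[OF seminormed_path_space assms(3)] .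
  have "norm (x t - x 0) \<le> nnorm (path_space T \<omega> p) x * \<omega> 0 t powr (1 / p)"
    using assms by (intro path_increment_le) auto
  also have "\<dots> \<le> nnorm (path_space T \<omega> p) x * \<omega> 0 T powr (1 / p)"
    using control_le[OF assms(1), of 0 t] assms nn by (intro mult_left_mono powr_mono2) auto
  finally show ?thesis
    using path_initial_le[OF assms(3)] norm_triangle_sub[of "x t" "x 0"]
    by (simp add: algebra_simps)
qed

section \<open>Derivatives of functions of Hoelder class\<close>

text \<open>The class in evaluated form, at fixed lists of directions. One constant \<open>K\<close>
  and one exponent \<open>\<gamma>\<close> serve all orders up to \<open>k\<close>, so that the
  later estimates treat the top order like the others.\<close>

locale holder_jet =
  fixes k :: nat and \<gamma> K :: real
    and D :: "nat \<Rightarrow> 'v::real_normed_vector \<Rightarrow> 'v list \<Rightarrow> 'w::real_normed_vector"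
  assumes \<gamma>: "0 < \<gamma>" "\<gamma> \<le> 1" and K: "0 \<le> K"
    and multilin: "j \<le> k \<Longrightarrow> D j y \<in> ncarrier (tmultilin j)"
    and bound: "j \<le> k \<Longrightarrow> length hs = j \<Longrightarrow> norm (D j y hs) \<le> K * prod_list (map norm hs)"
    and holder: "j \<le> k \<Longrightarrow> length hs = j \<Longrightarrow>
      norm (D j z hs - D j y hs) \<le> K * norm (z - y) powr \<gamma> * prod_list (map norm hs)"
    and derivative: "j < k \<Longrightarrow> length hs = j \<Longrightarrow>
      ((\<lambda>y. D j y hs) has_derivative (\<lambda>h. D (Suc j) y (h # hs))) (at y)"

text \<open>A bounded Lipschitz function is Hoelder: interpolate between the two bounds.\<close>

lemma min_le_powr:
  fixes x :: real
  assumes "0 \<le> x" "0 < \<gamma>" "\<gamma> \<le> 1" shows "min 1 x \<le> x powr \<gamma>"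
proof (cases "x \<le> 1")
  case True
  then show ?thesis
    using assms powr_mono'[of \<gamma> 1 x] by simp
next
  case False
  then show ?thesis
    using assms by (simp add: ge_one_powr_ge_zero)
qed

text \<open>Only the top order comes with a Hoelder bound. A lower order is bounded and, by the mean
  value inequality and the bound on the next derivative, Lipschitz, so \<open>min_le_powr\<close>
  gives it the exponent \<open>\<gamma>\<close> too.\<close>

lemma holder_class_imp_holder_jet:
  fixes f :: "'v::real_normed_vector \<Rightarrow> 'w::real_normed_vector"
  assumes \<gamma>: "0 < \<gamma>" "\<gamma> \<le> 1" and f: "holder_class k \<gamma> type_nspace type_nspace UNIV f"
  obtains K D where "holder_jet k \<gamma> K D" "\<And>y. D 0 y [] = f y"
proof -
  obtain D :: "nat \<Rightarrow> 'v \<Rightarrow> 'v list \<Rightarrow> 'w" where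
    D0: "\<And>y. D 0 y = (\<lambda>hs. if hs = [] then f y else 0)"
    and Dm: "\<And>j y. j \<le> k \<Longrightarrow> D j y \<in> ncarrier (tmultilin j)"
    and Db: "\<And>j. j \<le> k \<Longrightarrow> nbounded_on (tmultilin j) UNIV (D j)"
    and Dd: "\<And>j y. j < k \<Longrightarrow>
      has_nfrechet type_nspace (tmultilin j) UNIV (D j) (\<lambda>h hs. D (Suc j) y (h # hs)) y"
    and Dh: "nholder_on type_nspace (tmultilin k) \<gamma> UNIV (D k)"
    using f unfolding holder_class_def by (elim conjE exE) (rule that; simp)
  have mb: "\<exists>C. mbound type_nspace type_nspace j M C" if "M \<in> ncarrier (tmultilin j)"
    for j and M :: "'v list \<Rightarrow> 'w"
    using that by (simp add: ncarrier_multilin_iff)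
  note sub = multilin_diff[OF seminormed_type_nspace seminormed_type_nspace]
  have eval: "norm (M hs) \<le> B * prod_list (map norm hs)"
    if "M \<in> ncarrier (tmultilin j)" "length hs = j" "nnorm (tmultilin j) M \<le> B"
    for j B hs and M :: "'v list \<Rightarrow> 'w"
    using mb[OF that(1)] norm_tmultilin_le that(2,3) by blast
  have nonneg: "0 \<le> prod_list (map norm hs)" for hs :: "'v list"
    by (intro prod_list_map_nonneg) auto

  have deriv: "((\<lambda>y. D j y hs) has_derivative (\<lambda>h. D (Suc j) y (h # hs))) (at y)"
    if j: "j < k" and hs: "length hs = j" for j y hs
    unfolding has_derivative_within_alt
  proof (intro conjI allI impI)
    define P where "P = prod_list (map norm hs)"
    have P: "0 \<le> P"
      using nonneg by (simp add: P_def)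
    have S: "D (Suc j) y \<in> ncarrier (tmultilin (Suc j))"
      using Dm[of "Suc j" y] j by simp
    obtain C where C: "mbound type_nspace type_nspace (Suc j) (D (Suc j) y) C"
      using mb[OF S] by blast
    show "bounded_linear (\<lambda>h. D (Suc j) y (h # hs))"
    proof (rule bounded_linear_intro)
      show "D (Suc j) y ((a + b) # hs) = D (Suc j) y (a # hs) + D (Suc j) y (b # hs)" for a b
        using multilin_Cons_linear(1)[OF S] hs by simp
      show "D (Suc j) y ((c *\<^sub>R a) # hs) = c *\<^sub>R D (Suc j) y (a # hs)" for c a
        using multilin_Cons_linear(2)[OF S] hs by simp
      show "norm (D (Suc j) y (h # hs)) \<le> norm h * (C * P)" for h
        using eval[OF S _ nnorm_multilin_le[OF C], of "h # hs"] hs by (simp add: P_def mult_ac)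
    qed
    fix e :: real assume e: "0 < e"
    \<comment> \<open>Evaluation at \<open>hs\<close> multiplies the remainder by \<open>P\<close>,
      so the tolerance is divided beforehand; the \<open>+ 1\<close> covers
      \<open>P = 0\<close>.\<close>
    define e' where "e' = e / (P + 1)"
    have e': "0 < e'" "e' * P \<le> e"
      using e P by (auto simp: e'_def field_simps)
    obtain d where d: "0 < d" and *: "\<And>z. norm (z - y) < d \<Longrightarrow>
        nnorm (tmultilin j) (D j z - D j y - (\<lambda>hs. D (Suc j) y ((z - y) # hs))) \<le> e' * norm (z - y)"
      using Dd[OF j, of y] e'(1) unfolding has_nfrechet_def by auto
    have "norm (D j z hs - D j y hs - D (Suc j) y ((z - y) # hs)) \<le> e * norm (z - y)"
      if z: "norm (z - y) < d" for z
    proof -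
      have "(\<lambda>hs. D (Suc j) y ((z - y) # hs)) \<in> ncarrier (tmultilin j)"
        using multilin_Cons[OF seminormed_type_nspace _ S] by simp
      then have "D j z - D j y - (\<lambda>hs. D (Suc j) y ((z - y) # hs)) \<in> ncarrier (tmultilin j)"
        using Dm[of j] j by (intro sub) auto
      from eval[OF this hs *[OF z]]
      have "norm (D j z hs - D j y hs - D (Suc j) y ((z - y) # hs)) \<le> (e' * P) * norm (z - y)"
        by (simp add: P_def mult_ac)
      also have "\<dots> \<le> e * norm (z - y)"
        using e' by (intro mult_right_mono) auto
      finally show ?thesis .
    qed
    then show "\<exists>d>0. \<forall>z\<in>UNIV. norm (z - y) < d \<longrightarrow>
        norm (D j z hs - D j y hs - D (Suc j) y ((z - y) # hs)) \<le> e * norm (z - y)"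
      using d by blast
  qed

  have "\<exists>B. \<forall>j\<le>k. 0 \<le> B j \<and> (\<forall>y hs. length hs = j \<longrightarrow> norm (D j y hs) \<le> B j * prod_list (map norm hs))"
  proof (intro choice_iff'[THEN iffD1] allI impI)
    fix j assume j: "j \<le> k"
    obtain C where C: "\<And>y. nnorm (tmultilin j) (D j y) \<le> C"
      using Db[OF j] unfolding nbounded_on_def by auto
    have "norm (D j y hs) \<le> max C 0 * prod_list (map norm hs)" if "length hs = j" for y hs
      using eval[OF Dm[OF j] that, of y "max C 0"] C[of y] by simp
    then show "\<exists>B. 0 \<le> B \<and> (\<forall>y hs. length hs = j \<longrightarrow> norm (D j y hs) \<le> B * prod_list (map norm hs))"
      by (intro exI[of _ "max C 0"]) auto
  qed
  then obtain B where B0: "\<And>j. j \<le> k \<Longrightarrow> 0 \<le> B j"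
    and B: "\<And>j y hs. j \<le> k \<Longrightarrow> length hs = j \<Longrightarrow> norm (D j y hs) \<le> B j * prod_list (map norm hs)"
    by blast
  obtain H where H: "\<And>y z. nnorm (tmultilin k) (D k z - D k y) \<le> H * norm (z - y) powr \<gamma>"
    using Dh unfolding nholder_on_def by auto
  \<comment> \<open>\<open>\<bar>H\<bar>\<close> serves the top order; the sum dominates every
    \<open>B j\<close> at once, and the factor 2 is for increments, which are bounded by two
    values.\<close>
  define K where "K = \<bar>H\<bar> + 2 * sum B {..k}"
  have BK: "2 * B j \<le> K" "0 \<le> K" if "j \<le> k" for j
    using member_le_sum[of j "{..k}" B] B0 that by (auto simp: K_def intro!: sum_nonneg add_nonneg_nonneg)
  have K1: "B j \<le> K" if "j \<le> k" for j
    using BK[OF that] B0[OF that] by simp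

  have "holder_jet k \<gamma> K D"
  proof
    show "0 < \<gamma>" "\<gamma> \<le> 1" "0 \<le> K"
      using \<gamma> BK(2)[of k] by auto
    show "D j y \<in> ncarrier (tmultilin j)" if "j \<le> k" for j y
      by (rule Dm[OF that])
    show "norm (D j y hs) \<le> K * prod_list (map norm hs)" if "j \<le> k" "length hs = j" for j hs y
      using B[OF that, of y] mult_right_mono[OF K1[OF that(1)] nonneg[of hs]] by linarith
    show "((\<lambda>y. D j y hs) has_derivative (\<lambda>h. D (Suc j) y (h # hs))) (at y)"
      if "j < k" "length hs = j" for j hs y
      by (rule deriv[OF that])
    show "norm (D j z hs - D j y hs) \<le> K * norm (z - y) powr \<gamma> * prod_list (map norm hs)"
      if j: "j \<le> k" and hs: "length hs = j" for j hs z y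
    proof (cases "j = k")
      case True
      have "D k z - D k y \<in> ncarrier (tmultilin k)"
        by (intro sub Dm) auto
      then have "norm (D k z hs - D k y hs) \<le> H * norm (z - y) powr \<gamma> * prod_list (map norm hs)"
        using eval[OF _ _ H] hs True by fastforce
      also have "\<dots> \<le> K * norm (z - y) powr \<gamma> * prod_list (map norm hs)"
        using B0 by (intro mult_right_mono nonneg) (auto simp: K_def intro!: add_increasing2 sum_nonneg)
      finally show ?thesis
        using True by simp
    next
      case False
      then have jk: "j < k"
        using j by simp
      define P where "P = prod_list (map norm hs)"
      have P: "0 \<le> P"
        using nonneg by (simp add: P_def)
      have "norm (D j z hs - D j y hs) \<le> B j * P + B j * P"
        using B[OF j hs] norm_triangle_ineq4 add_mono order_trans unfolding P_def by meson
      also have "\<dots> \<le> K * P"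
        using mult_right_mono[OF BK(1)[OF j] P] by (simp add: mult_ac)
      finally have 1: "norm (D j z hs - D j y hs) \<le> K * P" .
      have "norm (D j z hs - D j y hs) \<le> (K * P) * norm (z - y)"
      proof (rule differentiable_bound[of UNIV])
        show "((\<lambda>y. D j y hs) has_derivative (\<lambda>h. D (Suc j) x (h # hs))) (at x within UNIV)" for x
          using deriv[OF jk hs] by simp
        show "onorm (\<lambda>h. D (Suc j) x (h # hs)) \<le> K * P" for x
        proof (rule onorm_bound)
          show "0 \<le> K * P"
            using BK(2)[OF j] P by simp
          fix h
          have "norm (D (Suc j) x (h # hs)) \<le> B (Suc j) * (norm h * P)"
            using B[of "Suc j" "h # hs"] jk hs by (simp add: P_def)
          also have "\<dots> \<le> K * (norm h * P)"
            using K1[of "Suc j"] jk P by (intro mult_right_mono) auto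
          finally show "norm (D (Suc j) x (h # hs)) \<le> K * P * norm h"
            by (simp add: mult_ac)
        qed
      qed auto
      then have "norm (D j z hs - D j y hs) \<le> (K * P) * min 1 (norm (z - y))"
        using 1 by (auto simp: min_def)
      also have "\<dots> \<le> (K * P) * norm (z - y) powr \<gamma>"
        using \<gamma> BK(2)[OF j] P by (intro mult_left_mono min_le_powr) auto
      finally show ?thesis
        by (simp add: P_def mult_ac)
    qed
  qed
  moreover have "D 0 y [] = f y" for y
    by (simp add: D0)
  ultimately show ?thesis
    by (rule that)
qed

section \<open>Derivatives of the Nemytskii operator\<close>

text \<open>A remainder of order \<open>1 + \<alpha>\<close> suffices. It is asked for at distance
  at most 1 only, so that \<open>C\<close> may come from a ball around \<open>y\<close> even when
  \<open>S\<close> is unbounded.\<close>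

lemma has_nfrechetI_powr:
  assumes X: "seminormed X" and S: "S \<subseteq> ncarrier X" "y \<in> S" and F: "F ` S \<subseteq> ncarrier Y"
    and lin: "nbounded_linear X Y F'" and "0 < \<alpha>"
    and rem: "\<And>z. z \<in> S \<Longrightarrow> nnorm X (z - y) \<le> 1 \<Longrightarrow>
      nnorm Y (F z - F y - F' (z - y)) \<le> C * nnorm X (z - y) powr \<alpha> * nnorm X (z - y)"
  shows "has_nfrechet X Y S F F' y"
  unfolding has_nfrechet_def
proof (intro conjI allI impI S F lin)
  fix \<epsilon> :: real assume e: "0 < \<epsilon>"
  define B where "B = \<bar>C\<bar> + 1"
  have B: "0 < B" "C \<le> B"
    by (auto simp: B_def)
  define \<delta> where "\<delta> = min 1 ((\<epsilon> / B) powr (1 / \<alpha>))"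
  have "nnorm Y (F z - F y - F' (z - y)) \<le> \<epsilon> * nnorm X (z - y)"
    if z: "z \<in> S" "nnorm X (z - y) < \<delta>" for z
  proof -
    let ?d = "nnorm X (z - y)"
    have d: "0 \<le> ?d"
      using seminormedD(5)[OF X seminormed_diff(1)[OF X]] S z by auto
    have "?d powr \<alpha> \<le> ((\<epsilon> / B) powr (1 / \<alpha>)) powr \<alpha>"
      using \<open>0 < \<alpha>\<close> z d by (intro powr_mono2) (auto simp: \<delta>_def)
    also have "\<dots> = \<epsilon> / B"
      using \<open>0 < \<alpha>\<close> e B by (simp add: powr_powr)
    finally have "B * ?d powr \<alpha> \<le> \<epsilon>"
      using B by (simp add: field_simps)
    moreover have "C * ?d powr \<alpha> \<le> B * ?d powr \<alpha>"
      using B by (intro mult_right_mono) auto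
    ultimately have "C * ?d powr \<alpha> * ?d \<le> \<epsilon> * ?d"
      using d by (intro mult_right_mono) auto
    then show ?thesis
      using rem[OF z(1)] z(2) by (auto simp: \<delta>_def)
  qed
  moreover have "0 < \<delta>"
    using e B by (simp add: \<delta>_def)
  ultimately show "\<exists>\<delta>>0. \<forall>z\<in>S. nnorm X (z - y) < \<delta> \<longrightarrow>
      nnorm Y (F z - F y - F' (z - y)) \<le> \<epsilon> * nnorm X (z - y)"
    by blast
qed

text \<open>Converts maps on one-element lists to linear maps. \<open>L\<close> has to agree with
  \<open>M\<close> on the carrier only, since \<open>M\<close> is 0 elsewhere while a pointwise
  formula for \<open>L\<close> need not be.\<close>

lemma nbounded_linear_multilin_1:
  assumes X: "seminormed X" and M: "M \<in> ncarrier (multilin X Y 1)"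
    and L: "\<And>h. h \<in> ncarrier X \<Longrightarrow> L h = M [h]"
  shows "nbounded_linear X Y L"
proof -
  have M: "M \<in> ncarrier (multilin X Y (Suc 0))"
    using M by simp
  have nil: "[] \<in> mlists X 0"
    by (simp add: mlists_def)
  obtain C where C: "mbound X Y (Suc 0) M C"
    using M by (auto simp: ncarrier_multilin_iff)
  have 1: "[h] \<in> mlists X (Suc 0)" if "h \<in> ncarrier X" for h
    using that by (simp add: mlists_def)
  have "M [h] \<in> ncarrier Y" if "h \<in> ncarrier X" for h
    using M 1[OF that] by (simp add: ncarrier_multilin_iff)
  moreover have "nnorm Y (M [h]) \<le> C * nnorm X h" if "h \<in> ncarrier X" for h
  proof -
    have "nnorm Y (M [h]) \<le> C * prod_list (map (nnorm X) [h])"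
      using C 1[OF that] unfolding mbound_def by blast
    then show ?thesis
      by simp
  qed
  ultimately show ?thesis
    unfolding nbounded_linear_def
    using multilin_Cons_linear[OF M nil] seminormedD(1,3)[OF X] by (auto simp: L)
qed

text \<open>Mean value inequality for \<open>\<lambda>u. g u - u *\<^sub>R l\<close> against the
  majorant \<open>\<lambda>u. B * u\<close>. With \<open>l\<close> the derivative at
  \<open>u = 0\<close> this bounds the first order Taylor remainder.\<close>

lemma norm_remainder_le:
  fixes g :: "real \<Rightarrow> 'a::real_normed_vector"
  assumes "\<And>u. 0 \<le> u \<Longrightarrow> u \<le> 1 \<Longrightarrow> (g has_vector_derivative g' u) (at u)"
    and "\<And>u. 0 \<le> u \<Longrightarrow> u \<le> 1 \<Longrightarrow> norm (g' u - l) \<le> B"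
  shows "norm (g 1 - g 0 - l) \<le> B"
proof -
  let ?h = "\<lambda>u. g u - u *\<^sub>R l"
  have d: "(?h has_vector_derivative (g' u - l)) (at u)" if "0 \<le> u" "u \<le> 1" for u
    using has_vector_derivative_diff[OF assms(1)[OF that]
        bounded_linear.has_vector_derivative[OF bounded_linear_scaleR_left has_vector_derivative_id, of l]]
    by simp
  have "norm (?h 1 - ?h 0) \<le> B * 1 - B * 0"
  proof (rule differentiable_bound_general[where f' = "\<lambda>u. g' u - l" and \<phi>' = "\<lambda>_. B"])
    show "continuous_on {0..1} ?h"
      using has_vector_derivative_continuous[OF d] by (intro continuous_at_imp_continuous_on) simp
    show "((*) B has_vector_derivative B) (at x)" for x
      using has_vector_derivative_mult_right[OF has_vector_derivative_id, of B "at x"] by simp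
    show "continuous_on {0..1} ((*) B)"
      by (intro continuous_intros)
  qed (use d assms(2) in auto)
  then show ?thesis
    by (simp add: algebra_simps)
qed

text \<open>Write \<open>S\<close> as \<open>S powr (1 - \<kappa>) * S powr \<kappa>\<close> and use
  one estimate in each factor; the powers of the common factor \<open>c\<close> recombine to
  \<open>c\<close>.\<close>

lemma le_interpolate:
  fixes S c u v \<kappa> :: real
  assumes "0 \<le> S" "0 \<le> c" "0 \<le> u" "0 \<le> v" "0 < \<kappa>" "\<kappa> < 1" "S \<le> c * u" "S \<le> c * v"
  shows "S \<le> c * (u powr (1 - \<kappa>) * v powr \<kappa>)"
proof -
  have "S = S powr (1 - \<kappa>) * S powr \<kappa>"
    using assms(1) by (simp flip: powr_add)
  also have "\<dots> \<le> (c * u) powr (1 - \<kappa>) * (c * v) powr \<kappa>"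
    using assms by (intro mult_mono powr_mono2) auto
  also have "\<dots> = (c powr (1 - \<kappa>) * c powr \<kappa>) * (u powr (1 - \<kappa>) * v powr \<kappa>)"
    using assms by (simp add: powr_mult mult_ac)
  also have "c powr (1 - \<kappa>) * c powr \<kappa> = c"
    using assms(2) by (simp flip: powr_add)
  finally show ?thesis .
qed

section \<open>Pointwise lifts of the derivatives to path spaces\<close>

locale path_jet = holder_jet k \<gamma> K D
  for k \<gamma> K and D :: "nat \<Rightarrow> 'v::real_normed_vector \<Rightarrow> 'v list \<Rightarrow> 'w::real_normed_vector" +
  fixes T p q \<kappa> :: real and \<omega> :: "real \<Rightarrow> real \<Rightarrow> real"
  assumes T: "0 < T" and control: "control T \<omega>" and p: "1 \<le> p" and \<kappa>: "0 < \<kappa>" "\<kappa> < 1"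
    and q: "q = p / (\<kappa> * \<gamma>)"
begin

abbreviation X :: "(real \<Rightarrow> 'v) nspace" where "X \<equiv> path_space T \<omega> p"
abbreviation Y :: "(real \<Rightarrow> 'w) nspace" where "Y \<equiv> path_space T \<omega> q"
abbreviation \<alpha> where "\<alpha> \<equiv> (1 - \<kappa>) * \<gamma>"
abbreviation W where "W \<equiv> \<omega> 0 T"
abbreviation A where "A \<equiv> 1 + W powr (1 / p)"
abbreviation P where "P hs \<equiv> prod_list (map (nnorm X) hs)"

text \<open>Two guards keep this inside the carriers: 0 off the admissible lists, as
  \<open>multilin\<close> demands, and \<open>path_of\<close>, because \<open>D j (y t)\<close> need
  not vanish at times outside \<open>[0, T]\<close>.\<close>

definition lift :: "nat \<Rightarrow> (real \<Rightarrow> 'v) \<Rightarrow> (real \<Rightarrow> 'v) list \<Rightarrow> real \<Rightarrow> 'w"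
  where "lift j y hs =
    (if hs \<in> mlists X j then path_of T (\<lambda>t. D j (y t) (map (\<lambda>h. h t) hs)) else 0)"

lemma lift_apply:
  "hs \<in> mlists X j \<Longrightarrow> 0 \<le> t \<Longrightarrow> t \<le> T \<Longrightarrow> lift j y hs t = D j (y t) (map (\<lambda>h. h t) hs)"
  by (simp add: lift_def path_of_def)

lemma \<alpha>: "0 < \<alpha>"
  using \<kappa> \<gamma> by simp

lemma exponents: "1 / q = \<gamma> / p * \<kappa>" "1 / q \<le> \<gamma> / p" "\<gamma> / p \<le> 1 / p"
proof -
  show eq: "1 / q = \<gamma> / p * \<kappa>"
    by (simp add: q)
  show "1 / q \<le> \<gamma> / p"
    unfolding eq using \<gamma> p \<kappa> by (intro mult_right_le_one_le) auto
  show "\<gamma> / p \<le> 1 / p"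
    using \<gamma> p by (intro divide_right_mono) auto
qed

lemma P_nonneg: "hs \<in> mlists X j \<Longrightarrow> 0 \<le> P hs"
  by (rule seminormed_prod_list_nonneg[OF seminormed_path_space]) (simp add: mlists_def)

lemma norm_X_le: "x \<in> ncarrier X \<Longrightarrow> 0 \<le> t \<Longrightarrow> t \<le> T \<Longrightarrow> norm (x t) \<le> A * nnorm X x"
  by (rule norm_path_le[OF control]) (use p in auto)

lemma prod_list_scaled: "prod_list (map (\<lambda>h. A * nnorm X h) hs) = A ^ length hs * P hs"
  by (induction hs) (auto simp: mult_ac)

lemma prod_list_eval_le:
  assumes "hs \<in> mlists X j" "0 \<le> t" "t \<le> T"
  shows "prod_list (map norm (map (\<lambda>h. h t) hs)) \<le> A ^ j * P hs"
proof -
  have "prod_list (map (\<lambda>h. norm (h t)) hs) \<le> prod_list (map (\<lambda>h. A * nnorm X h) hs)"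
    using assms norm_X_le by (intro prod_list_map_mono) (auto simp: mlists_def)
  then show ?thesis
    using assms(1) unfolding prod_list_scaled by (simp add: mlists_def comp_def)
qed

lemma norm_eval_le:
  assumes "\<And>gs. length gs = j \<Longrightarrow> norm (M gs) \<le> B * prod_list (map norm gs)" "0 \<le> B"
    and "hs \<in> mlists X j" "0 \<le> t" "t \<le> T"
  shows "norm (M (map (\<lambda>h. h t) hs)) \<le> B * (A ^ j * P hs)"
proof -
  have "norm (M (map (\<lambda>h. h t) hs)) \<le> B * prod_list (map norm (map (\<lambda>h. h t) hs))"
    using assms(1)[of "map (\<lambda>h. h t) hs"] assms(3) by (simp add: mlists_def)
  also have "\<dots> \<le> B * (A ^ j * P hs)"
    by (rule mult_left_mono[OF prod_list_eval_le[OF assms(3-5)] assms(2)])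
  finally show ?thesis .
qed

text \<open>Fixed map, moving arguments: telescoping with weights \<open>A * nnorm X h\<close> and
  \<open>\<delta> = \<omega> s t powr (1 / p)\<close>. As \<open>A \<ge> 1\<close>, the same weight
  dominates the values of \<open>h\<close> and, after the factor \<open>\<delta>\<close>, its
  increment.\<close>

lemma norm_eval_diff_le:
  assumes M: "M \<in> ncarrier (tmultilin j)"
    "\<And>gs. length gs = j \<Longrightarrow> norm (M gs) \<le> B * prod_list (map norm gs)" "0 \<le> B"
    and hs: "hs \<in> mlists X j" and st: "0 \<le> s" "s \<le> t" "t \<le> T"
  shows "norm (M (map (\<lambda>h. h t) hs) - M (map (\<lambda>h. h s) hs))
    \<le> B * real j * \<omega> s t powr (1 / p) * (A ^ j * P hs)"
proof -
  have len: "length hs = j" and X: "\<And>h. h \<in> set hs \<Longrightarrow> h \<in> ncarrier X"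
    using hs by (auto simp: mlists_def)
  have "norm (h t - h s) \<le> \<omega> s t powr (1 / p) * (A * nnorm X h)" if "h \<in> set hs" for h
  proof -
    have "norm (h t - h s) \<le> 1 * nnorm X h * \<omega> s t powr (1 / p)"
      using path_increment_le[OF X[OF that] st] by simp
    also have "\<dots> \<le> A * nnorm X h * \<omega> s t powr (1 / p)"
      using seminormedD(5)[OF seminormed_path_space X[OF that]]
      by (intro mult_right_mono) auto
    finally show ?thesis
      by (simp only: mult_ac)
  qed
  then have "norm (M (map (\<lambda>h. h t) hs) - M (map (\<lambda>h. h s) hs))
    \<le> B * real (length hs) * \<omega> s t powr (1 / p) * prod_list (map (\<lambda>h. A * nnorm X h) hs)"
    using M X norm_X_le st by (intro norm_tmultilin_map_diff_le) (auto simp: len)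
  then show ?thesis
    unfolding prod_list_scaled len .
qed

text \<open>The increment is split in two: the base point moves from \<open>y s\<close> to
  \<open>y t\<close> with the arguments taken at \<open>t\<close>, and the arguments move with the
  base point at \<open>y s\<close>. The constant sees \<open>y\<close> only through
  \<open>R\<close>.\<close>

lemma lift_bound:
  assumes j: "j \<le> k" and R: "0 \<le> R"
  shows "\<exists>C\<ge>0. \<forall>y\<in>ncarrier X. \<forall>hs\<in>mlists X j. nnorm X y \<le> R \<longrightarrow>
      norm (lift j y hs 0) \<le> C * P hs \<and> path_bound T \<omega> q (lift j y hs) (C * P hs)"
proof -
  \<comment> \<open>The three summands pay for the initial value, the motion of the base point and
    the motion of the arguments; the powers of \<open>W\<close> lower the exponents
    \<open>\<gamma> / p\<close> and \<open>1 / p\<close> to \<open>1 / q\<close>.\<close>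
  define C where "C = K * A ^ j *
    (1 + R powr \<gamma> * W powr (\<gamma> / p - 1 / q) + real j * W powr (1 / p - 1 / q))"
  have C0: "0 \<le> C"
    using K by (auto simp: C_def intro!: mult_nonneg_nonneg add_nonneg_nonneg)
  have KC: "K * A ^ j \<le> C"
  proof -
    have "K * A ^ j * 1 \<le> C"
      unfolding C_def using K by (intro mult_left_mono) (auto intro: add_nonneg_nonneg)
    then show ?thesis
      by simp
  qed
  have "norm (lift j y hs 0) \<le> C * P hs \<and> path_bound T \<omega> q (lift j y hs) (C * P hs)"
    if y: "y \<in> ncarrier X" "nnorm X y \<le> R" and hs: "hs \<in> mlists X j" for y hs
  proof (intro conjI)
    note P = P_nonneg[OF hs]
    have len: "length hs = j"
      using hs by (simp add: mlists_def)
    have "norm (lift j y hs 0) \<le> K * (A ^ j * P hs)"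
      using norm_eval_le[OF bound[OF j, where y = "y 0"] K hs, of 0] T lift_apply[OF hs] by simp
    also have "\<dots> \<le> C * P hs"
      using mult_right_mono[OF KC P] by (simp add: mult_ac)
    finally show "norm (lift j y hs 0) \<le> C * P hs" .
    show "path_bound T \<omega> q (lift j y hs) (C * P hs)"
      unfolding path_bound_def
    proof (intro conjI allI impI)
      show "0 \<le> C * P hs"
        using C0 P by simp
      fix s t assume "0 \<le> s \<and> s \<le> t \<and> t \<le> T"
      then have st: "0 \<le> s" "s \<le> t" "t \<le> T"
        by auto
      define Q where "Q = A ^ j * P hs"
      define w where "w = \<omega> s t powr (1 / q)"
      have Q: "0 \<le> Q"
        using P by (simp add: Q_def)
      let ?ht = "map (\<lambda>h. h t) hs" and ?hs = "map (\<lambda>h. h s) hs"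
      have dy: "norm (y t - y s) powr \<gamma> \<le> R powr \<gamma> * W powr (\<gamma> / p - 1 / q) * w"
      proof -
        have "norm (y t - y s) \<le> R * \<omega> s t powr (1 / p)"
          using path_increment_le[OF y(1) st] mult_right_mono[OF y(2), of "\<omega> s t powr (1 / p)"] by simp
        then have "norm (y t - y s) powr \<gamma> \<le> (R * \<omega> s t powr (1 / p)) powr \<gamma>"
          using \<gamma> by (intro powr_mono2) auto
        also have "\<dots> = R powr \<gamma> * \<omega> s t powr (\<gamma> / p)"
          using R by (simp add: powr_mult powr_powr)
        also have "\<dots> \<le> R powr \<gamma> * (W powr (\<gamma> / p - 1 / q) * w)"
          unfolding w_def using exponents(2) st by (intro mult_left_mono control_powr_le[OF control]) auto
        finally show ?thesis
          by (simp add: mult_ac)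
      qed
      have 1: "norm (D j (y t) ?ht - D j (y s) ?ht) \<le> K * (R powr \<gamma> * W powr (\<gamma> / p - 1 / q) * w) * Q"
      proof -
        have "norm (D j (y t) ?ht - D j (y s) ?ht) \<le>
            K * norm (y t - y s) powr \<gamma> * prod_list (map norm ?ht)"
          using holder[OF j, of ?ht "y t" "y s"] len by simp
        also have "\<dots> \<le> K * (R powr \<gamma> * W powr (\<gamma> / p - 1 / q) * w) * Q"
          using dy K Q prod_list_eval_le[OF hs, of t] st unfolding Q_def
          by (intro mult_mono prod_list_map_nonneg) (auto intro!: mult_nonneg_nonneg simp: w_def)
        finally show ?thesis .
      qed
      have 2: "norm (D j (y s) ?ht - D j (y s) ?hs) \<le> K * real j * (W powr (1 / p - 1 / q) * w) * Q"
      proof -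
        have "norm (D j (y s) ?ht - D j (y s) ?hs) \<le> K * real j * \<omega> s t powr (1 / p) * Q"
          unfolding Q_def using multilin[OF j] bound[OF j] K hs st by (intro norm_eval_diff_le)
        also have "\<dots> \<le> K * real j * (W powr (1 / p - 1 / q) * w) * Q"
          unfolding w_def using exponents(2,3) st K Q
          by (intro mult_right_mono mult_left_mono control_powr_le[OF control]) auto
        finally show ?thesis .
      qed
      have "norm (lift j y hs t - lift j y hs s) =
          norm ((D j (y t) ?ht - D j (y s) ?ht) + (D j (y s) ?ht - D j (y s) ?hs))"
        using st lift_apply[OF hs] by simp
      also have "\<dots> \<le> K * (R powr \<gamma> * W powr (\<gamma> / p - 1 / q) * w) * Q
          + K * real j * (W powr (1 / p - 1 / q) * w) * Q"
        by (rule order_trans[OF norm_triangle_ineq add_mono[OF 1 2]])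
      also have "\<dots> \<le> K * (R powr \<gamma> * W powr (\<gamma> / p - 1 / q) * w) * Q
          + K * real j * (W powr (1 / p - 1 / q) * w) * Q + K * w * Q"
        using K Q by (simp add: w_def)
      also have "\<dots> = C * P hs * w"
        by (simp add: C_def Q_def algebra_simps)
      finally show "norm (lift j y hs t - lift j y hs s) \<le> C * P hs * \<omega> s t powr (1 / q)"
        by (simp add: w_def)
    qed
  qed
  with C0 show ?thesis
    by blast
qed

text \<open>The factor 2 appears because the path norm adds the initial value and the seminorm, each
  bounded by \<open>C * P hs\<close>.\<close>

lemma mbound_pathI:
  assumes "0 \<le> C"
    and "\<And>hs. hs \<in> mlists X j \<Longrightarrow> norm (M hs 0) \<le> C * P hs \<and> path_bound T \<omega> q (M hs) (C * P hs)"
  shows "mbound X Y j M (2 * C)"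
  unfolding mbound_def
proof (intro conjI ballI)
  show "0 \<le> 2 * C"
    using assms(1) by simp
  fix hs assume "hs \<in> mlists X j"
  from nnorm_path_space_le[OF conjunct1 conjunct2, OF assms(2) assms(2), OF this this]
  show "nnorm Y (M hs) \<le> 2 * C * P hs"
    by simp
qed

lemma lift_mbound:
  assumes "j \<le> k" "0 \<le> R"
  shows "\<exists>C. \<forall>y\<in>ncarrier X. nnorm X y \<le> R \<longrightarrow> mbound X Y j (lift j y) C"
  using lift_bound[OF assms] mbound_pathI by blast

text \<open>Multilinearity holds at each time separately; \<open>lift_bound\<close>, with the norm
  of \<open>y\<close> as \<open>R\<close>, supplies membership in the path space and the
  bound.\<close>

lemma lift_multilin:
  assumes j: "j \<le> k" and y: "y \<in> ncarrier X"
  shows "lift j y \<in> ncarrier (multilin X Y j)"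
proof -
  have R: "0 \<le> nnorm X y"
    using seminormedD(5)[OF seminormed_path_space y] .
  have upd: "map (\<lambda>h. h t) (hs[i := a]) = (map (\<lambda>h. h t) hs)[i := a t]" for hs i and a :: "real \<Rightarrow> 'v" and t
    by (simp add: map_update)
  have upd_in: "hs[i := a] \<in> mlists X j" if "hs \<in> mlists X j" "a \<in> ncarrier X" for hs i a
    using that set_update_subset_insert[of hs i a] by (auto simp: mlists_def)
  have D_add: "D j v (gs[i := a + b]) = D j v (gs[i := a]) + D j v (gs[i := b])"
    and D_scale: "D j v (gs[i := c *\<^sub>R a]) = c *\<^sub>R D j v (gs[i := a])"
    if "length gs = j" "i < j" for v gs i a b c
    using multilin[OF j, of v] that by (simp_all add: ncarrier_multilin_iff)
  obtain C where C: "\<And>hs. hs \<in> mlists X j \<Longrightarrow>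
      norm (lift j y hs 0) \<le> C * P hs \<and> path_bound T \<omega> q (lift j y hs) (C * P hs)" "0 \<le> C"
    using lift_bound[OF j R] y by (metis order_refl)
  show ?thesis
    unfolding ncarrier_multilin_iff
  proof (intro conjI ballI allI impI)
    fix hs assume hs: "hs \<in> mlists X j"
    then show "lift j y hs \<in> ncarrier Y"
      using C(1)[OF hs] by (auto simp: ncarrier_path_space_iff lift_def path_of_def)
  next
    fix hs assume "hs \<notin> mlists X j"
    then show "lift j y hs = 0"
      by (simp add: lift_def)
  next
    fix hs i a b assume *: "hs \<in> mlists X j" "i < j" "a \<in> ncarrier X" "b \<in> ncarrier X"
    moreover have "a + b \<in> ncarrier X"
      using seminormedD(1)[OF seminormed_path_space] * by blast
    moreover have "length hs = j"
      using * by (simp add: mlists_def)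
    ultimately show "lift j y (hs[i := a + b]) = lift j y (hs[i := a]) + lift j y (hs[i := b])"
      by (simp add: lift_def upd_in path_of_def fun_eq_iff upd D_add)
  next
    fix hs i c a assume *: "hs \<in> mlists X j" "i < j" "a \<in> ncarrier X"
    moreover have "c *\<^sub>R a \<in> ncarrier X"
      using seminormedD(3)[OF seminormed_path_space] * by blast
    moreover have "length hs = j"
      using * by (simp add: mlists_def)
    ultimately show "lift j y (hs[i := c *\<^sub>R a]) = c *\<^sub>R lift j y (hs[i := a])"
      by (simp add: lift_def upd_in path_of_def fun_eq_iff upd D_scale scaleR_fun_def)
  next
    show "\<exists>C. mbound X Y j (lift j y) C"
      using mbound_pathI[OF C(2,1)] by blast
  qed
qed

text \<open>
  With \<open>G = D j z - D j y\<close> along the two paths, the increment of \<open>G\<close> is small both because \<open>z - y\<close>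
  is small and because the paths are regular; interpolating between the two bounds gives a factor
  \<open>\<parallel>z - y\<parallel>\<close> to the power \<open>\<alpha>\<close> and leaves the regularity \<open>1 / q\<close>.
\<close>

lemma lift_holder_bound:
  assumes j: "j \<le> k" and R: "0 \<le> R"
  shows "\<exists>C\<ge>0. \<forall>y\<in>ncarrier X. \<forall>z\<in>ncarrier X. \<forall>hs\<in>mlists X j. nnorm X y \<le> R \<longrightarrow> nnorm X z \<le> R \<longrightarrow>
      (let x = lift j z hs - lift j y hs; B = C * nnorm X (z - y) powr \<alpha> * P hs in
        norm (x 0) \<le> B \<and> path_bound T \<omega> q x B)"
proof -
  \<comment> \<open>\<open>E\<close> bounds the surplus power of the distance, as
    \<open>nnorm X (z - y) \<le> 2 * R\<close>; \<open>F\<close> is the contribution of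
    \<open>R\<close> to the interpolated regularity in time; \<open>V\<close> lowers the exponent
    \<open>1 / p\<close> of the arguments to \<open>1 / q\<close>.\<close>
  define E where "E = (A * (2 * R)) powr (\<gamma> * \<kappa>)"
  define F where "F = R powr (\<gamma> * \<kappa>)"
  define V where "V = W powr (1 / p - 1 / q)"
  define C where "C = K * A powr \<alpha> * A ^ j * (E + real j * E * V + 2 * F)"
  have nn: "0 \<le> E" "0 \<le> F" "0 \<le> V"
    by (auto simp: E_def F_def V_def)
  have C0: "0 \<le> C"
    using K nn by (auto simp: C_def intro!: mult_nonneg_nonneg add_nonneg_nonneg)
  have "norm ((lift j z hs - lift j y hs) 0) \<le> C * nnorm X (z - y) powr \<alpha> * P hs \<and>
      path_bound T \<omega> q (lift j z hs - lift j y hs) (C * nnorm X (z - y) powr \<alpha> * P hs)"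
    if y: "y \<in> ncarrier X" "nnorm X y \<le> R" and z: "z \<in> ncarrier X" "nnorm X z \<le> R"
      and hs: "hs \<in> mlists X j" for y z hs
  proof -
    define d where "d = nnorm X (z - y)"
    define Q where "Q = A ^ j * P hs"
    define a where "a = A powr \<alpha> * d powr \<alpha>"
    note zy = seminormed_diff[OF seminormed_path_space z(1) y(1)]
    have d: "0 \<le> d" "d \<le> 2 * R"
      using seminormedD(5)[OF seminormed_path_space zy(1)] zy(2) y z by (auto simp: d_def)
    have Q: "0 \<le> Q"
      using P_nonneg[OF hs] by (simp add: Q_def)
    have a: "0 \<le> a"
      by (simp add: a_def)
    have Ad0: "0 \<le> A * d"
      using d by (intro mult_nonneg_nonneg) auto
    \<comment> \<open>Since \<open>\<gamma> = \<alpha> + \<gamma> * \<kappa>\<close>, the power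
      \<open>\<alpha>\<close> of the distance is kept and the rest is bounded by
      \<open>E\<close>.\<close>
    have Ad: "(A * d) powr \<gamma> \<le> a * E"
    proof -
      have "(A * d) powr \<gamma> = (A * d) powr \<alpha> * (A * d) powr (\<gamma> * \<kappa>)"
        by (simp add: algebra_simps flip: powr_add)
      also have "\<dots> \<le> (A * d) powr \<alpha> * E"
        unfolding E_def using d \<gamma> \<kappa> Ad0 by (intro mult_left_mono powr_mono2) auto
      also have "(A * d) powr \<alpha> = a"
        unfolding a_def using d by (intro powr_mult)
      finally show ?thesis .
    qed
    have zyt: "norm (z t - y t) powr \<gamma> \<le> (A * d) powr \<gamma>" if "0 \<le> t" "t \<le> T" for t
      using norm_X_le[OF zy(1) that] \<gamma> by (intro powr_mono2) (auto simp: d_def)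
    define G where "G t = D j (z t) - D j (y t)" for t
    have G_in: "G t \<in> ncarrier (tmultilin j)" for t
      unfolding G_def by (intro multilin_diff multilin seminormed_type_nspace j)
    have G_le: "norm (G t gs) \<le> K * (A * d) powr \<gamma> * prod_list (map norm gs)"
      if "length gs = j" "0 \<le> t" "t \<le> T" for gs t
    proof -
      have "norm (G t gs) \<le> K * norm (z t - y t) powr \<gamma> * prod_list (map norm gs)"
        using holder[OF j that(1), of "z t" "y t"] by (simp add: G_def)
      also have "\<dots> \<le> K * (A * d) powr \<gamma> * prod_list (map norm gs)"
        using zyt that K by (intro mult_right_mono mult_left_mono prod_list_map_nonneg) auto
      finally show ?thesis .
    qed
    have KA: "0 \<le> K * (A * d) powr \<gamma>"
      using K by simp
    have G_eval: "norm (G t (map (\<lambda>h. h s) hs)) \<le> K * (A * d) powr \<gamma> * Q"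
      if "0 \<le> t" "t \<le> T" "0 \<le> s" "s \<le> T" for s t
      unfolding Q_def using G_le that by (intro norm_eval_le KA hs) auto
    have lift_G: "(lift j z hs - lift j y hs) t = G t (map (\<lambda>h. h t) hs)" if "0 \<le> t" "t \<le> T" for t
      using lift_apply[OF hs that] by (simp add: G_def)
    have C_eq: "C * d powr \<alpha> * P hs = K * a * (E + real j * E * V + 2 * F) * Q"
      by (simp add: C_def a_def Q_def mult_ac)
    have C_nn: "0 \<le> K * a * (real j * E * V + 2 * F) * Q"
      using K a nn Q by (intro mult_nonneg_nonneg add_nonneg_nonneg) auto
    have "norm ((lift j z hs - lift j y hs) 0) \<le> K * (a * E) * Q"
      using G_eval[of 0 0] T lift_G[of 0] mult_right_mono[OF mult_left_mono[OF Ad K] Q] by simp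
    then have "norm ((lift j z hs - lift j y hs) 0) \<le> C * d powr \<alpha> * P hs"
      using C_nn unfolding C_eq by (simp add: algebra_simps)
    moreover have "path_bound T \<omega> q (lift j z hs - lift j y hs) (C * d powr \<alpha> * P hs)"
      unfolding path_bound_def
    proof (intro conjI allI impI)
      show "0 \<le> C * d powr \<alpha> * P hs"
        using C0 P_nonneg[OF hs] by simp
      fix s t assume "0 \<le> s \<and> s \<le> t \<and> t \<le> T"
      then have st: "0 \<le> s" "s \<le> t" "t \<le> T" "s \<le> T" "0 \<le> t"
        by auto
      define w where "w = \<omega> s t powr (1 / q)"
      have w: "0 \<le> w"
        by (simp add: w_def)
      let ?ht = "map (\<lambda>h. h t) hs" and ?hs = "map (\<lambda>h. h s) hs"
      \<comment> \<open>The arguments move under the small map \<open>G t\<close>: smallness and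
        regularity come from different factors, so here both gains multiply.\<close>
      have 1: "norm (G t ?ht - G t ?hs) \<le> K * (a * E) * real j * (V * w) * Q"
      proof -
        have "norm (G t ?ht - G t ?hs) \<le> K * (A * d) powr \<gamma> * real j * \<omega> s t powr (1 / p) * Q"
          unfolding Q_def using G_le st by (intro norm_eval_diff_le G_in KA hs) auto
        also have "\<dots> \<le> K * (a * E) * real j * (V * w) * Q"
        proof (intro mult_right_mono mult_mono)
          show "\<omega> s t powr (1 / p) \<le> V * w"
            unfolding V_def w_def using exponents st by (intro control_powr_le[OF control]) auto
        qed (use Ad K Q a nn in auto)
        finally show ?thesis .
      qed
      have 2: "norm (G t ?hs - G s ?hs) \<le> 2 * K * Q * (a * (F * w))"
      proof -
        have len: "length ?hs = j"
          using hs by (simp add: mlists_def)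
        \<comment> \<open>Grouping by time: \<open>G t\<close> and \<open>G s\<close> are each
          small.\<close>
        have small: "norm (G t ?hs - G s ?hs) \<le> (2 * K * Q) * (A * d) powr \<gamma>"
          using norm_triangle_ineq4[of "G t ?hs" "G s ?hs"] G_eval[of t s] G_eval[of s s] st
          by (simp add: mult_ac)
        have incr: "norm (D j (x t) ?hs - D j (x s) ?hs) \<le> K * (R * \<omega> s t powr (1 / p)) powr \<gamma> * Q"
          if x: "x \<in> ncarrier X" "nnorm X x \<le> R" for x
        proof -
          have "norm (x t - x s) \<le> R * \<omega> s t powr (1 / p)"
            using path_increment_le[OF x(1), of s t] st
              mult_right_mono[OF x(2), of "\<omega> s t powr (1 / p)"] by simp
          then have xts: "norm (x t - x s) powr \<gamma> \<le> (R * \<omega> s t powr (1 / p)) powr \<gamma>"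
            using \<gamma> by (intro powr_mono2) auto
          have "norm (D j (x t) ?hs - D j (x s) ?hs) \<le>
              K * norm (x t - x s) powr \<gamma> * prod_list (map norm ?hs)"
            by (rule holder[OF j len])
          also have "\<dots> \<le> K * (R * \<omega> s t powr (1 / p)) powr \<gamma> * Q"
            unfolding Q_def using xts K st
            by (intro mult_mono prod_list_eval_le[OF hs] prod_list_map_nonneg) auto
          finally show ?thesis .
        qed
        \<comment> \<open>The same four terms regrouped by path: each bracket is an increment in
          time along \<open>z\<close> or \<open>y\<close>.\<close>
        have "G t ?hs - G s ?hs = (D j (z t) ?hs - D j (z s) ?hs) - (D j (y t) ?hs - D j (y s) ?hs)"
          by (simp add: G_def)
        then have regular: "norm (G t ?hs - G s ?hs) \<le> (2 * K * Q) * (R * \<omega> s t powr (1 / p)) powr \<gamma>"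
          using incr[OF y] incr[OF z]
            norm_triangle_ineq4[of "D j (z t) ?hs - D j (z s) ?hs" "D j (y t) ?hs - D j (y s) ?hs"]
          by (simp add: mult_ac)
        have "norm (G t ?hs - G s ?hs) \<le>
            2 * K * Q * (((A * d) powr \<gamma>) powr (1 - \<kappa>) * ((R * \<omega> s t powr (1 / p)) powr \<gamma>) powr \<kappa>)"
          using small regular K Q \<kappa> by (intro le_interpolate) auto
        also have "((A * d) powr \<gamma>) powr (1 - \<kappa>) = a"
          using d by (simp add: powr_powr powr_mult a_def mult.commute)
        also have "((R * \<omega> s t powr (1 / p)) powr \<gamma>) powr \<kappa> = F * w"
          using R by (simp add: powr_powr powr_mult F_def w_def exponents(1))
        finally show ?thesis .
      qed
      have "norm ((lift j z hs - lift j y hs) t - (lift j z hs - lift j y hs) s)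
          = norm ((G t ?ht - G t ?hs) + (G t ?hs - G s ?hs))"
        unfolding lift_G[OF st(1,4)] lift_G[OF st(5,3)] by simp
      also have "\<dots> \<le> K * (a * E) * real j * (V * w) * Q + 2 * K * Q * (a * (F * w))"
        by (rule order_trans[OF norm_triangle_ineq add_mono[OF 1 2]])
      \<comment> \<open>The added nonnegative term is the share of the summand \<open>E\<close> in
        \<open>C\<close>, which served the initial value.\<close>
      also have "\<dots> \<le> K * (a * E) * real j * (V * w) * Q + 2 * K * Q * (a * (F * w)) + K * a * E * Q * w"
        using K a nn Q w by simp
      also have "\<dots> = C * d powr \<alpha> * P hs * w"
        unfolding C_eq by (simp add: algebra_simps)
      finally show "norm ((lift j z hs - lift j y hs) t - (lift j z hs - lift j y hs) s)
          \<le> C * d powr \<alpha> * P hs * \<omega> s t powr (1 / q)"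
        by (simp add: w_def)
    qed
    ultimately show ?thesis
      by (simp add: d_def)
  qed
  with C0 show ?thesis
    unfolding Let_def by blast
qed

text \<open>
  The increments of the remainder are controlled by the mean value inequality on \<open>y + u (z - y)\<close>,
  to whose derivative in \<open>u\<close> the Hoelder bound of order \<open>j + 1\<close> applies.
\<close>

lemma lift_remainder_bound:
  assumes j: "j < k" and R: "0 \<le> R"
  shows "\<exists>C\<ge>0. \<forall>y\<in>ncarrier X. \<forall>z\<in>ncarrier X. nnorm X y \<le> R \<longrightarrow> nnorm X z \<le> R \<longrightarrow>
      mbound X Y j (lift j z - lift j y - (\<lambda>hs. lift (Suc j) y ((z - y) # hs)))
        (2 * (C * nnorm X (z - y) powr \<alpha> * nnorm X (z - y)))"
proof -
  have Sj: "Suc j \<le> k"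
    using j by simp
  obtain C where C0: "0 \<le> C" and C: "\<And>y z hs. y \<in> ncarrier X \<Longrightarrow> z \<in> ncarrier X \<Longrightarrow>
      hs \<in> mlists X (Suc j) \<Longrightarrow> nnorm X y \<le> R \<Longrightarrow> nnorm X z \<le> R \<Longrightarrow>
      norm ((lift (Suc j) z hs - lift (Suc j) y hs) 0) \<le> C * nnorm X (z - y) powr \<alpha> * P hs \<and>
      path_bound T \<omega> q (lift (Suc j) z hs - lift (Suc j) y hs) (C * nnorm X (z - y) powr \<alpha> * P hs)"
    using lift_holder_bound[OF Sj R] unfolding Let_def by blast
  have "mbound X Y j (lift j z - lift j y - (\<lambda>hs. lift (Suc j) y ((z - y) # hs)))
      (2 * (C * nnorm X (z - y) powr \<alpha> * nnorm X (z - y)))"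
    if y: "y \<in> ncarrier X" "nnorm X y \<le> R" and z: "z \<in> ncarrier X" "nnorm X z \<le> R" for y z
  proof (rule mbound_pathI)
    define d where "d = z - y"
    have d: "d \<in> ncarrier X" "0 \<le> nnorm X d"
      unfolding d_def using seminormed_diff(1)[OF seminormed_path_space z(1) y(1)]
        seminormedD(5)[OF seminormed_path_space] by auto
    show "0 \<le> C * nnorm X (z - y) powr \<alpha> * nnorm X (z - y)"
      using C0 d by (simp add: d_def)
    fix hs assume hs: "hs \<in> mlists X j"
    have dhs: "d # hs \<in> mlists X (Suc j)"
      using d hs by (simp add: Cons_mlists_iff)
    define B where "B = C * nnorm X d powr \<alpha> * nnorm X d * P hs"
    have B0: "0 \<le> B"
      using C0 d P_nonneg[OF hs] by (simp add: B_def)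
    define x where "x u = y + u *\<^sub>R d" for u
    define E where "E u = lift (Suc j) (x u) (d # hs) - lift (Suc j) y (d # hs)" for u
    \<comment> \<open>By convexity the segment stays in the ball of radius \<open>R\<close>, so one
      constant serves all \<open>u\<close>; the slot filled with \<open>d\<close> contributes the
      extra factor \<open>nnorm X d\<close> in \<open>B\<close>.\<close>
    have E: "norm (E u 0) \<le> B \<and> path_bound T \<omega> q (E u) B" if u: "0 \<le> u" "u \<le> 1" for u
    proof -
      have ud: "u *\<^sub>R d \<in> ncarrier X" "nnorm X (u *\<^sub>R d) \<le> nnorm X d"
        using seminormedD(3,4)[OF seminormed_path_space d(1), of u] mult_right_mono[OF u(2) d(2)] u(1)
        by auto
      have xu: "x u \<in> ncarrier X"
        unfolding x_def by (rule seminormedD(1)[OF seminormed_path_space y(1) ud(1)])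
      have "x u = (1 - u) *\<^sub>R y + u *\<^sub>R z"
        by (simp add: x_def d_def algebra_simps)
      then have "nnorm X (x u) \<le> nnorm X ((1 - u) *\<^sub>R y) + nnorm X (u *\<^sub>R z)"
        using seminormedD(2,3)[OF seminormed_path_space] y(1) z(1) by metis
      also have "\<dots> \<le> (1 - u) * nnorm X y + u * nnorm X z"
        using seminormedD(4)[OF seminormed_path_space y(1), of "1 - u"]
          seminormedD(4)[OF seminormed_path_space z(1), of u] u by simp
      also have "\<dots> \<le> (1 - u) * R + u * R"
        using y z u by (intro add_mono mult_left_mono) auto
      finally have xuR: "nnorm X (x u) \<le> R"
        by (simp add: algebra_simps)
      have le: "C * nnorm X (x u - y) powr \<alpha> * P (d # hs) \<le> B"
      proof -
        have "nnorm X (x u - y) powr \<alpha> \<le> nnorm X d powr \<alpha>"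
          using ud seminormedD(5)[OF seminormed_path_space ud(1)] \<alpha>
          by (intro powr_mono2) (auto simp: x_def)
        then have "C * nnorm X (x u - y) powr \<alpha> * P (d # hs) \<le> C * nnorm X d powr \<alpha> * P (d # hs)"
          using C0 P_nonneg[OF dhs] by (intro mult_right_mono mult_left_mono)
        then show ?thesis
          by (simp add: B_def mult_ac)
      qed
      have "norm (E u 0) \<le> B"
        using C[OF y(1) xu dhs y(2) xuR] le unfolding E_def by linarith
      moreover have "path_bound T \<omega> q (E u) B"
        unfolding path_bound_def
      proof (intro conjI allI impI B0)
        fix s t assume "0 \<le> s \<and> s \<le> t \<and> t \<le> T"
        then have "norm (E u t - E u s) \<le> C * nnorm X (x u - y) powr \<alpha> * P (d # hs) * \<omega> s t powr (1 / q)"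
          using C[OF y(1) xu dhs y(2) xuR] unfolding E_def path_bound_def by blast
        also have "\<dots> \<le> B * \<omega> s t powr (1 / q)"
          by (intro mult_right_mono le) auto
        finally show "norm (E u t - E u s) \<le> B * \<omega> s t powr (1 / q)" .
      qed
      ultimately show ?thesis ..
    qed
    define g where "g t u = D j (x u t) (map (\<lambda>h. h t) hs)" for t u
    define g' where "g' t u = D (Suc j) (x u t) (d t # map (\<lambda>h. h t) hs)" for t u
    define l where "l t = D (Suc j) (y t) (d t # map (\<lambda>h. h t) hs)" for t
    have g: "(g t has_vector_derivative g' t u) (at u)" for t u
    proof -
      have len: "length (map (\<lambda>h. h t) hs) = j"
        using hs by (simp add: mlists_def)
      have "((\<lambda>u. x u t) has_vector_derivative d t) (at u)"
        using has_vector_derivative_add[OF has_vector_derivative_const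
            bounded_linear.has_vector_derivative[OF bounded_linear_scaleR_left has_vector_derivative_id]]
        by (simp add: x_def scaleR_fun_def)
      from vector_derivative_diff_chain_within[OF this
          has_derivative_at_withinI[OF derivative[OF j len]]]
      show ?thesis
        by (simp add: g_def[abs_def] g'_def comp_def)
    qed
    have E_eq: "E u t = g' t u - l t" if "0 \<le> t" "t \<le> T" for u t
      using lift_apply[OF dhs that] by (simp add: E_def g'_def l_def)
    define r where "r = lift j z hs - lift j y hs - lift (Suc j) y (d # hs)"
    have r: "r t = g t 1 - g t 0 - l t" if "0 \<le> t" "t \<le> T" for t
      using lift_apply[OF hs that] lift_apply[OF dhs that]
      by (simp add: r_def g_def l_def x_def d_def)
    have "norm (r 0) \<le> B"
    proof -
      have "norm (g 0 1 - g 0 0 - l 0) \<le> B"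
        using E E_eq[of 0] T by (intro norm_remainder_le[OF g]) auto
      then show ?thesis
        using r[of 0] T by simp
    qed
    moreover have "path_bound T \<omega> q r B"
      unfolding path_bound_def
    proof (intro conjI allI impI B0)
      fix s t assume st: "0 \<le> s \<and> s \<le> t \<and> t \<le> T"
      \<comment> \<open>The mean value inequality is applied to \<open>g t - g s\<close> as one
        function of \<open>u\<close>: its derivative minus \<open>l t - l s\<close> is the increment
        of the path \<open>E u\<close>. Estimating the two times separately would lose the factor
        \<open>\<omega> s t powr (1 / q)\<close>.\<close>
      have "norm ((g t 1 - g s 1) - (g t 0 - g s 0) - (l t - l s)) \<le> B * \<omega> s t powr (1 / q)"
      proof (rule norm_remainder_le[OF has_vector_derivative_diff[OF g g]])
        fix u :: real assume u: "0 \<le> u" "u \<le> 1"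
        have "g' t u - g' s u - (l t - l s) = E u t - E u s"
          using E_eq[of t u] E_eq[of s u] st by simp
        then show "norm (g' t u - g' s u - (l t - l s)) \<le> B * \<omega> s t powr (1 / q)"
          using E[OF u] st by (simp add: path_bound_def)
      qed
      moreover have "r t - r s = (g t 1 - g s 1) - (g t 0 - g s 0) - (l t - l s)"
        using r[of s] r[of t] st by simp
      ultimately show "norm (r t - r s) \<le> B * \<omega> s t powr (1 / q)"
        by simp
    qed
    ultimately show "norm ((lift j z - lift j y - (\<lambda>hs. lift (Suc j) y ((z - y) # hs))) hs 0)
          \<le> C * nnorm X (z - y) powr \<alpha> * nnorm X (z - y) * P hs \<and>
        path_bound T \<omega> q ((lift j z - lift j y - (\<lambda>hs. lift (Suc j) y ((z - y) # hs))) hs)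
          (C * nnorm X (z - y) powr \<alpha> * nnorm X (z - y) * P hs)"
      by (simp add: r_def d_def B_def)
  qed
  with C0 show ?thesis
    by blast
qed

text \<open>The unit ball about \<open>y\<close> lies in the centred ball of radius
  \<open>nnorm X y + 1\<close>, which makes the constant uniform in \<open>z\<close> near
  \<open>y\<close>.\<close>

lemma lift_local_remainder:
  assumes j: "j < k" and y: "y \<in> ncarrier X"
  shows "\<exists>C. \<forall>z\<in>ncarrier X. nnorm X (z - y) \<le> 1 \<longrightarrow>
      mbound X Y j (lift j z - lift j y - (\<lambda>hs. lift (Suc j) y ((z - y) # hs)))
        (C * nnorm X (z - y) powr \<alpha> * nnorm X (z - y))"
proof -
  have R: "0 \<le> nnorm X y + 1"
    using seminormedD(5)[OF seminormed_path_space y] by simp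
  obtain C where C: "\<And>z. z \<in> ncarrier X \<Longrightarrow> nnorm X z \<le> nnorm X y + 1 \<Longrightarrow>
      mbound X Y j (lift j z - lift j y - (\<lambda>hs. lift (Suc j) y ((z - y) # hs)))
        (2 * (C * nnorm X (z - y) powr \<alpha> * nnorm X (z - y)))"
    using lift_remainder_bound[OF j R] y by force
  have "nnorm X z \<le> nnorm X y + 1" if "z \<in> ncarrier X" "nnorm X (z - y) \<le> 1" for z
    using seminormedD(2)[OF seminormed_path_space
        seminormed_diff(1)[OF seminormed_path_space that(1) y] y] that(2) by simp
  then show ?thesis
    using C by (intro exI[of _ "2 * C"]) (simp add: mult.assoc)
qed

section \<open>Regularity of the lifts and of the operator\<close>

lemma lift_has_nfrechet:
  assumes j: "j < k" and S: "S \<subseteq> ncarrier X" "y \<in> S"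
  shows "has_nfrechet X (multilin X Y j) S (lift j) (\<lambda>h hs. lift (Suc j) y (h # hs)) y"
proof -
  have y: "y \<in> ncarrier X"
    using S by auto
  obtain C where "\<And>z. z \<in> ncarrier X \<Longrightarrow> nnorm X (z - y) \<le> 1 \<Longrightarrow>
      mbound X Y j (lift j z - lift j y - (\<lambda>hs. lift (Suc j) y ((z - y) # hs)))
        (C * nnorm X (z - y) powr \<alpha> * nnorm X (z - y))"
    using lift_local_remainder[OF j y] by blast
  then have "nnorm (multilin X Y j) (lift j z - lift j y - (\<lambda>hs. lift (Suc j) y ((z - y) # hs)))
      \<le> C * nnorm X (z - y) powr \<alpha> * nnorm X (z - y)" if "z \<in> S" "nnorm X (z - y) \<le> 1" for z
    using S that by (intro nnorm_multilin_le) auto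
  moreover have "lift j ` S \<subseteq> ncarrier (multilin X Y j)"
    using S j by (auto intro!: lift_multilin)
  moreover have "nbounded_linear X (multilin X Y j) (\<lambda>h hs. lift (Suc j) y (h # hs))"
    using j y by (intro nbounded_linear_multilin_Cons seminormed_path_space lift_multilin) auto
  ultimately show ?thesis
    using seminormed_path_space S \<alpha> by (intro has_nfrechetI_powr) auto
qed

lemma lift_nholder_on:
  assumes j: "j \<le> k" and R: "0 \<le> R" and S: "S \<subseteq> {y \<in> ncarrier X. nnorm X y \<le> R}"
  shows "nholder_on X (multilin X Y j) \<alpha> S (lift j)"
proof -
  obtain C where C0: "0 \<le> C" and C: "\<And>y z hs. y \<in> ncarrier X \<Longrightarrow> z \<in> ncarrier X \<Longrightarrow>
      hs \<in> mlists X j \<Longrightarrow> nnorm X y \<le> R \<Longrightarrow> nnorm X z \<le> R \<Longrightarrow>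
      norm ((lift j z hs - lift j y hs) 0) \<le> C * nnorm X (z - y) powr \<alpha> * P hs \<and>
      path_bound T \<omega> q (lift j z hs - lift j y hs) (C * nnorm X (z - y) powr \<alpha> * P hs)"
    using lift_holder_bound[OF j R] unfolding Let_def by blast
  have "mbound X Y j (lift j z - lift j y) (2 * (C * nnorm X (z - y) powr \<alpha>))" if "y \<in> S" "z \<in> S" for y z
  proof (rule mbound_pathI)
    show "0 \<le> C * nnorm X (z - y) powr \<alpha>"
      using C0 by simp
    fix hs assume "hs \<in> mlists X j"
    moreover have "y \<in> ncarrier X" "z \<in> ncarrier X" "nnorm X y \<le> R" "nnorm X z \<le> R"
      using that S by auto
    ultimately show "norm ((lift j z - lift j y) hs 0) \<le> C * nnorm X (z - y) powr \<alpha> * P hs \<and>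
        path_bound T \<omega> q ((lift j z - lift j y) hs) (C * nnorm X (z - y) powr \<alpha> * P hs)"
      using C by simp
  qed
  then show ?thesis
    unfolding nholder_on_def
    using nnorm_multilin_le by (intro exI[of _ "2 * C"]) (fastforce simp: mult.assoc)
qed

lemma lift_0: "lift 0 y = (\<lambda>hs. if hs = [] then nemytskii T (\<lambda>v. D 0 v []) y else 0)"
  by (auto simp: lift_def mlists_def nemytskii_def fun_eq_iff)

lemma nemytskii_in_path_space:
  assumes "y \<in> ncarrier X"
  shows "nemytskii T (\<lambda>v. D 0 v []) y \<in> ncarrier Y"
  using lift_multilin[OF le0 assms] by (simp add: ncarrier_multilin_iff lift_0 mlists_def)

lemma nemytskii_holder_class:
  assumes "0 \<le> R" and S: "S \<subseteq> {y \<in> ncarrier X. nnorm X y \<le> R}"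
  shows "holder_class k \<alpha> X Y S (nemytskii T (\<lambda>v. D 0 v []))"
  unfolding holder_class_def
proof (intro conjI exI[of _ lift] ballI allI impI)
  show SX: "S \<subseteq> ncarrier X"
    using S by auto
  show "nemytskii T (\<lambda>v. D 0 v []) ` S \<subseteq> ncarrier Y"
    using SX nemytskii_in_path_space by auto
  show "lift 0 y = (\<lambda>hs. if hs = [] then nemytskii T (\<lambda>v. D 0 v []) y else 0)" for y
    by (rule lift_0)
  show "nholder_on X (multilin X Y k) \<alpha> S (lift k)"
    by (rule lift_nholder_on[OF order_refl assms])
  fix j y
  show "has_nfrechet X (multilin X Y j) S (lift j) (\<lambda>h hs. lift (Suc j) y (h # hs)) y"
    if "j < k" "y \<in> S"
    by (rule lift_has_nfrechet[OF that(1) SX that(2)])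
  show "lift j y \<in> ncarrier (multilin X Y j)" if "j \<le> k" "y \<in> S"
    using that SX by (intro lift_multilin) auto
  assume j: "j \<le> k"
  obtain C where "\<And>y. y \<in> ncarrier X \<Longrightarrow> nnorm X y \<le> R \<Longrightarrow> mbound X Y j (lift j y) C"
    using lift_mbound[OF j assms(1)] by blast
  then show "nbounded_on (multilin X Y j) S (lift j)"
    using S nnorm_multilin_le unfolding nbounded_on_def by blast
  show "ncontinuous_on X (multilin X Y j) S (lift j)"
    by (rule nholder_on_imp_ncontinuous_on[OF seminormed_path_space SX \<alpha> lift_nholder_on[OF j assms]])
qed

text \<open>This is the remainder estimate of order 0 evaluated at \<open>[]\<close>, where the
  product of norms is 1. Being local, it gives the derivative relative to the whole carrier.\<close>

lemma nemytskii_has_nfrechet: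
  assumes k: "1 \<le> k" and y: "y \<in> ncarrier X"
  shows "has_nfrechet X Y (ncarrier X) (nemytskii T (\<lambda>v. D 0 v []))
    (\<lambda>h. path_of T (\<lambda>t. D 1 (y t) [h t])) y"
proof -
  have k0: "0 < k"
    using k by simp
  have nil: "[] \<in> mlists X 0"
    by (simp add: mlists_def)
  have lift_1: "path_of T (\<lambda>t. D 1 (y t) [h t]) = lift 1 y [h]" if "h \<in> ncarrier X" for h
    using that by (simp add: lift_def mlists_def)
  have lin: "nbounded_linear X Y (\<lambda>h. path_of T (\<lambda>t. D 1 (y t) [h t]))"
    using lift_1 by (intro nbounded_linear_multilin_1[OF seminormed_path_space lift_multilin[OF k y]])
  obtain C where C: "\<And>z. z \<in> ncarrier X \<Longrightarrow> nnorm X (z - y) \<le> 1 \<Longrightarrow>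
      mbound X Y 0 (lift 0 z - lift 0 y - (\<lambda>hs. lift (Suc 0) y ((z - y) # hs)))
        (C * nnorm X (z - y) powr \<alpha> * nnorm X (z - y))"
    using lift_local_remainder[OF k0 y] by blast
  have "nnorm Y (nemytskii T (\<lambda>v. D 0 v []) z - nemytskii T (\<lambda>v. D 0 v []) y
      - path_of T (\<lambda>t. D 1 (y t) [(z - y) t])) \<le> C * nnorm X (z - y) powr \<alpha> * nnorm X (z - y)"
    if z: "z \<in> ncarrier X" "nnorm X (z - y) \<le> 1" for z
  proof -
    have "nnorm Y ((lift 0 z - lift 0 y - (\<lambda>hs. lift (Suc 0) y ((z - y) # hs))) [])
        \<le> C * nnorm X (z - y) powr \<alpha> * nnorm X (z - y) * P []"
      using C[OF z] nil unfolding mbound_def by blast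
    then show ?thesis
      using lift_1[OF seminormed_diff(1)[OF seminormed_path_space z(1) y]] by (simp add: lift_0)
  qed
  then show ?thesis
    using seminormed_path_space y lin \<alpha> nemytskii_in_path_space by (intro has_nfrechetI_powr) auto
qed

end

theorem proposition2:
  fixes T p q \<gamma> \<kappa> :: real and \<omega> :: "real \<Rightarrow> real \<Rightarrow> real" and k :: nat
    and f :: "'v::banach \<Rightarrow> ('u::banach \<Rightarrow>\<^sub>L 'v)"
  assumes "0 < T" and "control T \<omega>"
    and "1 \<le> p" and "1 \<le> k" and "0 < \<gamma>" and "\<gamma> \<le> 1" and "0 < \<kappa>" and "\<kappa> < 1"
    and "q = p / (\<kappa> * \<gamma>)"
    and "holder_class k \<gamma> type_nspace type_nspace UNIV f"
  shows "(\<forall>c \<in> ncarrier (path_space T \<omega> p). \<forall>\<rho>>0.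
            holder_class k ((1 - \<kappa>) * \<gamma>) (path_space T \<omega> p) (path_space T \<omega> q)
              (nball (path_space T \<omega> p) c \<rho>) (nemytskii T f)) \<and>
         (\<forall>y \<in> ncarrier (path_space T \<omega> p).
            has_nfrechet (path_space T \<omega> p) (path_space T \<omega> q) (ncarrier (path_space T \<omega> p))
              (nemytskii T f)
              (\<lambda>h. path_of T (\<lambda>t. frechet_derivative f (at (y t)) (h t))) y \<and>
            (\<forall>h \<in> ncarrier (path_space T \<omega> p).
               path_of T (\<lambda>t. frechet_derivative f (at (y t)) (h t))
                 \<in> ncarrier (path_space T \<omega> q)) \<and>
            (\<forall>h \<in> path_space_star T \<omega> p.
               path_of T (\<lambda>t. frechet_derivative f (at (y t)) (h t))
                 \<in> path_space_star T \<omega> q))"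
proof -
  obtain K D where "holder_jet k \<gamma> K D" and D0: "\<And>v. D 0 v [] = f v"
    using holder_class_imp_holder_jet[OF assms(5,6,10)] by blast
  then interpret holder_jet k \<gamma> K D
    by simp
  interpret path_jet k \<gamma> K D T p q \<kappa> \<omega>
    by unfold_locales (use assms in auto)
  have f: "(\<lambda>v. D 0 v []) = f"
    by (simp add: D0)
  have f': "(f has_derivative (\<lambda>h. D 1 v [h])) (at v)" for v
    using derivative[of 0 "[]" v] assms(4) by (simp add: f)
  \<comment> \<open>Uniqueness of the derivative identifies \<open>frechet_derivative\<close> with
    \<open>D 1\<close>, whichever family of derivatives was obtained.\<close>
  have deriv: "frechet_derivative f (at v) = (\<lambda>h. D 1 v [h])" for v
    using frechet_derivative_at[OF f'] by simp
  show ?thesis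
    unfolding deriv
  proof (intro conjI ballI allI impI)
    fix c and \<rho> :: real assume c: "c \<in> ncarrier X" and \<rho>: "0 < \<rho>"
    \<comment> \<open>The constants are uniform on centred balls, so the ball about \<open>c\<close>
      is enclosed in one about 0.\<close>
    have "nnorm X y \<le> \<rho> + nnorm X c" if "y \<in> nball X c \<rho>" for y
      using that seminormedD(2)[OF seminormed_path_space seminormed_diff(1)[OF seminormed_path_space _ c] c, of y]
      by (auto simp: nball_def)
    then have "nball X c \<rho> \<subseteq> {y \<in> ncarrier X. nnorm X y \<le> \<rho> + nnorm X c}"
      by (auto simp: nball_def)
    then show "holder_class k \<alpha> X Y (nball X c \<rho>) (nemytskii T f)"
      using nemytskii_holder_class[of "\<rho> + nnorm X c"] \<rho> seminormedD(5)[OF seminormed_path_space c]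
      by (simp add: f)
  next
    fix y assume y: "y \<in> ncarrier X"
    show Df: "has_nfrechet X Y (ncarrier X) (nemytskii T f) (\<lambda>h. path_of T (\<lambda>t. D 1 (y t) [h t])) y"
      using nemytskii_has_nfrechet[OF assms(4) y] by (simp add: f)
    then show in_Y: "path_of T (\<lambda>t. D 1 (y t) [h t]) \<in> ncarrier Y" if "h \<in> ncarrier X" for h
      using that by (simp add: has_nfrechet_def nbounded_linear_def)
    fix h :: "real \<Rightarrow> 'v" assume h: "h \<in> path_space_star T \<omega> p"
    \<comment> \<open>The image path starts at 0 because the derivative at \<open>y 0\<close> is
      linear and \<open>h 0 = 0\<close>.\<close>
    have "D 1 (y 0) [0] = 0"
      using linear_0[OF has_derivative_linear[OF f']] .
    then show "path_of T (\<lambda>t. D 1 (y t) [h t]) \<in> path_space_star T \<omega> q"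
      using in_Y[of h] h assms(1) by (simp add: path_space_star_def path_of_def)
  qed
qed

end
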